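(* (Strong identifiability.) Let $\mathcal{S}\subseteq\mathbb{R}^n$ be open and connected, $\mathcal{X}\subseteq\mathbb{R}^m$, and $g:\mathcal{S}\to\mathcal{X}$ invertible and differentiable. Assume that the observed data satisfy the following generative model: latent positive pairs $(\mathbf{s},\tilde{\mathbf{s}})$ are generated by $\mathbf{s}\sim p_{\mathbf{s}}$ and $$p(\tilde{\mathbf{s}}\mid\mathbf{s})=\frac{Q(\tilde{\mathbf{s}})}{Z(\mathbf{s})}e^{-d(\mathbf{s},\tilde{\mathbf{s}})},\qquad Z(\mathbf{s})=\int_{\mathcal{S}}Q(\tilde{\mathbf{s}})e^{-d(\mathbf{s},\tilde{\mathbf{s}})}\,d\tilde{\mathbf{s}},$$ and the observed positive pairs are $(\mathbf{x},\tilde{\mathbf{x}})=(g(\mathbf{s}),g(\tilde{\mathbf{s}}))$. Let the function $d$ be defined by $$d(\mathbf{s},\tilde{\mathbf{s}})=\sum_i\left(|s_i-\tilde{s}_i|/\sigma_i\right)^{\beta},$$ with $\beta\in(0,2)\cup(2,\infty)$ and $\sigma_i>0$ for all $i$. Let the dissimilarity measure be of the form $$\delta(\mathbf{z},\tilde{\mathbf{z}})=\hat d(\mathbf{z},\tilde{\mathbf{z}})+\alpha(\mathbf{z})+\tilde\alpha(\tilde{\mathbf{z}})\quad\text{with }\hat d=d.$$ Then, for the optimal estimator of any of the four contrastive losses $\mathcal{L}_{\delta\text{-NCE}}$, $\mathcal{L}_{\delta\text{-INCE}}(\cdot,\cdot;K)$, $\mathcal{L}_{\delta\text{-SCL}}$,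 $\mathcal{L}_{\delta\text{-NWJ}}$, $h=f\circ g$ is a generalized permutation matrix, i.e., a composition of a permutation and element-wise scaling and sign flips.
   Context: **Data.** $\mathcal{S}$ is the space of latent factors, $\mathcal{X}$ the space of observations, and $n\le m$. $Q$ and $Z$ are scalar-valued functions. No constraint is imposed on the marginal distribution $p_{\mathbf{s}}$ of the latents except that its support must be connected; the latent factors are not assumed to be independent or conditionally independent ($Q$ need not factorize). $p_{\mathrm{pos}}$ is the distribution of observed positive pairs $(\mathbf{x},\tilde{\mathbf{x}})$, $p_{\mathbf{x}}$ is the distribution of $\mathbf{x}=g(\mathbf{s})$, and $p_{\mathbf{x}^-}$ is the distribution of negative samples, chosen to be nonzero on the support $\mathcal{X}$ (for example $p_{\mathbf{x}^-}=p_{\mathbf{x}}$). **Estimators.** $f:\mathcal{X}\to\mathcal{Z}\subseteq\mathbb{R}^n$ is the encoder; $\alpha,\tilde\alpha$ are learnable scalar-valued functions and $\hat d$ is a fixed expression. The encoder $f$ and the dissimilarity measure $\delta$ are assumed to have universal approximation capability. The optimal estimator of a loss is a pair $(f,\delta)$ that globally minimizes it. **Losses.** With $\mathrm{sig}$ the sigmoid function, and with $\mathbf{x}\sim p_{\mathbf{x}}$, $\mathbf{x}^-\sim p_{\mathbf{x}^-}$ independent in $\mathbb{E}_{\mathbf{x},\mathbf{x}^-}$: - $\mathcal{L}_{\delta\text{-NCE}}(f,\delta)=\mathbb{E}_{(\mathbf{x},\tilde{\mathbf{x}})\sim p_{\mathrm{pos}}}\big[-\log \mathrm{sig}(-\delta(f(\mathbf{x}),f(\tilde{\mathbf{x}})))\big]-\mathbb{E}_{\mathbf{x},\mathbf{x}^-}\big[\log(1-\mathrm{sig}(-\delta(f(\mathbf{x}),f(\mathbf{x}^-))))\big]$.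 - $\mathcal{L}_{\delta\text{-INCE}}(f,\delta;K)=\mathbb{E}\Big[-\log\dfrac{e^{-\delta(f(\mathbf{x}),f(\tilde{\mathbf{x}}))}}{e^{-\delta(f(\mathbf{x}),f(\tilde{\mathbf{x}}))}+\sum_{i=1}^K e^{-\delta(f(\mathbf{x}),f(\mathbf{x}_i^-))}}\Big]$, where $(\mathbf{x},\tilde{\mathbf{x}})\sim p_{\mathrm{pos}}$, $\mathbf{x}_1^-,\dots,\mathbf{x}_K^-$ are i.i.d. $\sim p_{\mathbf{x}^-}$, and $K\ge1$ is the number of negative examples. (This loss is invariant to changes in $\alpha$, and for it one sets $\alpha=0$.) - $\mathcal{L}_{\delta\text{-SCL}}(f,\delta)=\mathbb{E}_{(\mathbf{x},\tilde{\mathbf{x}})\sim p_{\mathrm{pos}}}\big[-2e^{-\delta(f(\mathbf{x}),f(\tilde{\mathbf{x}}))}\big]+\mathbb{E}_{\mathbf{x},\mathbf{x}^-}\big[e^{-2\delta(f(\mathbf{x}),f(\mathbf{x}^-))}\big]$. - $\mathcal{L}_{\delta\text{-NWJ}}(f,\delta)=\mathbb{E}_{(\mathbf{x},\tilde{\mathbf{x}})\sim p_{\mathrm{pos}}}\big[\delta(f(\mathbf{x}),f(\tilde{\mathbf{x}}))\big]+\mathbb{E}_{\mathbf{x},\mathbf{x}^-}\big[e^{-\delta(f(\mathbf{x}),f(\mathbf{x}^-))}\big]$.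
   Formalization: h is a generalized permutation matrix plus a translation (shifting f and the α's keeps the loss); it holds everywhere on S if f is continuous, almost everywhere if f is only measurable and p_s does not vanish on S; Q>0, p_s has support S, and the minimal loss is finite. *)

theory Defs
  imports "HOL-Probability.Probability"
begin

subsection \<open>Generative model\<close>

definition scaled_dist :: "('n::finite \<Rightarrow> real) \<Rightarrow> real \<Rightarrow> real^'n \<Rightarrow> real^'n \<Rightarrow> real" where
  "scaled_dist \<sigma> \<beta> s t = (\<Sum>i\<in>UNIV. (\<bar>s $ i - t $ i\<bar> / \<sigma> i) powr \<beta>)"

text \<open>A Bochner integral of a non-integrable function is 0, so positivity of
  \<open>partition_fn\<close> includes convergence of the integral.\<close>

definition partition_fn ::
  "(real^'n) set \<Rightarrow> (real^'n \<Rightarrow> real) \<Rightarrow> (real^'n \<Rightarrow> real^'n \<Rightarrow> real) \<Rightarrow> real^'n \<Rightarrow> real" where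
  "partition_fn S Q d s = (LINT t:S|lborel. Q t * exp (- d s t))"

definition latent_pos ::
  "(real^'n) set \<Rightarrow> (real^'n) measure \<Rightarrow> (real^'n \<Rightarrow> real) \<Rightarrow> (real^'n \<Rightarrow> real^'n \<Rightarrow> real)
    \<Rightarrow> ((real^'n) \<times> (real^'n)) measure" where
  "latent_pos S ps Q d =
     density (ps \<Otimes>\<^sub>M restrict_space lborel S)
       (\<lambda>(s, t). ennreal (Q t / partition_fn S Q d s * exp (- d s t)))"

text \<open>The map \<open>g\<close> is only constrained on \<open>S\<close>, so latent measures live on the subspace \<open>S\<close>
  and observation measures on the subspace \<open>X\<close>.\<close>

definition obs_marginal ::
  "(real^'m) set \<Rightarrow> (real^'n \<Rightarrow> real^'m) \<Rightarrow> (real^'n) measure \<Rightarrow> (real^'m) measure" where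
  "obs_marginal X g M = distr M (restrict_space borel X) g"

definition obs_pos ::
  "(real^'m) set \<Rightarrow> (real^'n \<Rightarrow> real^'m) \<Rightarrow> ((real^'n) \<times> (real^'n)) measure
    \<Rightarrow> ((real^'m) \<times> (real^'m)) measure" where
  "obs_pos X g M =
     distr M (restrict_space borel X \<Otimes>\<^sub>M restrict_space borel X) (map_prod g g)"

text \<open>The set \<open>X = g ` S\<close> may be a Lebesgue null set of the observation space, so the
  reference measure for densities on \<open>X\<close> is the image of Lebesgue measure on \<open>S\<close>.\<close>

definition has_nonzero_density :: "'a measure \<Rightarrow> 'a measure \<Rightarrow> bool" where
  "has_nonzero_density R P \<longleftrightarrow>
     (\<exists>w\<in>borel_measurable R. (\<forall>x\<in>space R. 0 < w x) \<and> P = density R (\<lambda>x. ennreal (w x)))"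

subsection \<open>Contrastive losses\<close>

text \<open>Expectation with values in the extended reals. In \<^typ>\<open>ereal\<close>,
  \<open>\<infinity> - \<infinity> = \<infinity>\<close> and \<open>-\<infinity> + \<infinity> = \<infinity>\<close>: an undefined loss has value
  \<open>\<infinity>\<close>, whereas a Bochner integral would give it the value 0.\<close>

definition ext_expectation :: "'a measure \<Rightarrow> ('a \<Rightarrow> real) \<Rightarrow> ereal" where
  "ext_expectation M u =
     enn2ereal (\<integral>\<^sup>+ x. ennreal (u x) \<partial>M) - enn2ereal (\<integral>\<^sup>+ x. ennreal (- u x) \<partial>M)"

definition sigmoid :: "real \<Rightarrow> real" where
  "sigmoid t = 1 / (1 + exp (- t))"

definition NCE_loss ::
  "('x \<times> 'x) measure \<Rightarrow> 'x measure \<Rightarrow> 'x measure \<Rightarrow> ('x \<Rightarrow> 'z) \<times> ('z \<Rightarrow> 'z \<Rightarrow> real) \<Rightarrow> ereal" where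
  "NCE_loss ppos px pneg = (\<lambda>(f, \<delta>).
     ext_expectation ppos (\<lambda>(x, y). - ln (sigmoid (- \<delta> (f x) (f y))))
     - ext_expectation (px \<Otimes>\<^sub>M pneg) (\<lambda>(x, y). ln (1 - sigmoid (- \<delta> (f x) (f y)))))"

definition INCE_loss ::
  "nat \<Rightarrow> ('x \<times> 'x) measure \<Rightarrow> 'x measure \<Rightarrow> ('x \<Rightarrow> 'z) \<times> ('z \<Rightarrow> 'z \<Rightarrow> real) \<Rightarrow> ereal" where
  "INCE_loss K ppos pneg = (\<lambda>(f, \<delta>).
     ext_expectation (ppos \<Otimes>\<^sub>M (\<Pi>\<^sub>M i\<in>{1..K}. pneg))
       (\<lambda>((x, y), xs). - ln (exp (- \<delta> (f x) (f y)) /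
          (exp (- \<delta> (f x) (f y)) + (\<Sum>i=1..K. exp (- \<delta> (f x) (f (xs i))))))))"

definition SCL_loss ::
  "('x \<times> 'x) measure \<Rightarrow> 'x measure \<Rightarrow> 'x measure \<Rightarrow> ('x \<Rightarrow> 'z) \<times> ('z \<Rightarrow> 'z \<Rightarrow> real) \<Rightarrow> ereal" where
  "SCL_loss ppos px pneg = (\<lambda>(f, \<delta>).
     ext_expectation ppos (\<lambda>(x, y). - 2 * exp (- \<delta> (f x) (f y)))
     + ext_expectation (px \<Otimes>\<^sub>M pneg) (\<lambda>(x, y). exp (- 2 * \<delta> (f x) (f y))))"

definition NWJ_loss ::
  "('x \<times> 'x) measure \<Rightarrow> 'x measure \<Rightarrow> 'x measure \<Rightarrow> ('x \<Rightarrow> 'z) \<times> ('z \<Rightarrow> 'z \<Rightarrow> real) \<Rightarrow> ereal" where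
  "NWJ_loss ppos px pneg = (\<lambda>(f, \<delta>).
     ext_expectation ppos (\<lambda>(x, y). \<delta> (f x) (f y))
     + ext_expectation (px \<Otimes>\<^sub>M pneg) (\<lambda>(x, y). exp (- \<delta> (f x) (f y))))"

subsection \<open>Optimal estimators\<close>

text \<open>Universal approximation: the encoder \<open>f\<close> and \<open>\<alpha>'\<close> range over all Borel functions and
  \<open>\<alpha>\<close> over the class \<open>\<A>\<close>. The InfoNCE loss does not depend on \<open>\<alpha>\<close>; there \<open>\<A> = {\<lambda>_. 0}\<close>.\<close>

definition estimators ::
  "(real^'m) set \<Rightarrow> (real^'n \<Rightarrow> real) set \<Rightarrow> (real^'n \<Rightarrow> real^'n \<Rightarrow> real)
    \<Rightarrow> ((real^'m \<Rightarrow> real^'n) \<times> (real^'n \<Rightarrow> real^'n \<Rightarrow> real)) set" where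
  "estimators X \<A> dhat =
     {(f, \<delta>). f \<in> borel_measurable (restrict_space borel X) \<and>
        (\<exists>\<alpha>\<in>\<A>. \<exists>\<alpha>'\<in>borel_measurable borel. \<delta> = (\<lambda>z z'. dhat z z' + \<alpha> z + \<alpha>' z'))}"

text \<open>A minimizer must have a finite loss: if the loss can be \<open>-\<infinity>\<close>, or is always \<open>\<infinity>\<close>,
  minimality says nothing about the estimator.\<close>

definition is_optimal :: "('e \<Rightarrow> ereal) \<Rightarrow> 'e set \<Rightarrow> 'e \<Rightarrow> bool" where
  "is_optimal loss C e \<longleftrightarrow> e \<in> C \<and> \<bar>loss e\<bar> \<noteq> \<infinity> \<and> (\<forall>e'\<in>C. loss e \<le> loss e')"

subsection \<open>Generalized permutation matrices\<close>

definition generalized_permutation :: "real^'n^'n \<Rightarrow> bool" where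
  "generalized_permutation A \<longleftrightarrow>
     (\<exists>\<pi> c. \<pi> permutes UNIV \<and> (\<forall>i. c i \<noteq> 0) \<and> A = (\<chi> i j. if j = \<pi> i then c i else 0))"

end

theory Submission
  imports Defs
begin

text \<open>For each loss the integrand is minimized pointwise exactly when \<open>exp (- \<delta>)\<close> is the density
  ratio of positive against negative pairs (for InfoNCE: up to a factor depending on the anchor), and
  the ideal estimator \<open>f = g\<inverse>\<close> realizes it. For the spectral loss the ideal estimator may have
  infinite loss and is approached through truncations. Hence an optimal \<open>h = f \<circ> g\<close> satisfies
  \<open>d (h s) (h t) = d s t + a s + b t\<close> for almost all \<open>s\<close> and \<open>t\<close>. Letting \<open>t\<close> tend to \<open>s'\<close> in one copy
  and to \<open>s\<close> in another copy of this equation eliminates \<open>a\<close> and \<open>b\<close>, so \<open>h\<close> preserves \<open>d\<close> on a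
  dense set. Such a map sends axis-parallel rectangles to axis-parallel rectangles: for \<open>\<beta> \<le> 1\<close> by the
  equality case of the quadrilateral inequality of the metric \<open>d\<close>, for \<open>\<beta> > 1\<close> because midpoints are
  preserved and Lamperti's inequality for \<open>|x + y|^\<beta> + |x - y|^\<beta>\<close> is strict unless \<open>x y = 0\<close>; the latter
  needs \<open>\<beta> \<noteq> 2\<close>. Hence each coordinate of \<open>h\<close> depends on a single coordinate of the argument.\<close>

section \<open>Inequalities for powers\<close>

text \<open>The two arguments of the equation are controlled by different measures: the anchor
  \<open>s\<close> up to null sets of \<open>ps\<close>, the partner \<open>t\<close> up to Lebesgue
  null sets. Eliminating \<open>a\<close> and \<open>b\<close> needs points that serve in both
  roles, and an \<open>h\<close> that is merely Borel cannot be evaluated by a limit. A point can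
  take the partner role if \<open>(s, h s)\<close> lies in the support of the image of Lebesgue
  measure under \<open>\<lambda>t. (t, h t)\<close>; this holds everywhere if \<open>h\<close> is
  continuous, and Lebesgue almost everywhere otherwise. Hence the two branches of the conclusion:
  continuity of \<open>f\<close>, or every \<open>ps\<close>-null set being Lebesgue null. In the
  second branch \<open>ps\<close> may still have a singular part; there the equation, with the form
  of \<open>h\<close> already known elsewhere, pins down \<open>h s\<close>. The geometry needs
  midpoints, hence convexity, so it is carried out on cubes, and connectedness of \<open>S\<close>
  glues the resulting affine maps.\<close>

lemma powr_midpoint_strict:
  fixes u v b :: real
  assumes "1 < b" "0 \<le> u" "0 \<le> v" "u \<noteq> v"
  shows "((u + v) / 2) powr b < (u powr b + v powr b) / 2"
proof -
  have *: "((u + v) / 2) powr b < (u powr b + v powr b) / 2" if uv: "0 \<le> u" "u < v" for u v :: real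
  proof -
    define m where "m = (u + v) / 2"
    have m: "u < m" "m < v" using uv by (auto simp: m_def)
    have c: "continuous_on {x..y} (\<lambda>x. x powr b)" if "0 \<le> x" for x y :: real
      using that \<open>1 < b\<close> by (intro continuous_on_powr' continuous_intros) auto
    have dv: "((\<lambda>x. x powr b) has_real_derivative b * x powr (b - 1)) (at x)" if "0 < x" for x :: real
      using that by (rule has_real_derivative_powr)
    \<comment> \<open>The mean value theorem asks for a derivative only inside the interval, so the
      interval may start at 0. The derivative \<open>b * z powr (b - 1)\<close> is strictly larger
      on the right half than on the left half.\<close>
    have mv: "\<exists>z. x < z \<and> z < y \<and> y powr b - x powr b = (y - x) * (b * z powr (b - 1))"
      if "0 \<le> x" "x < y" for x y :: real
    proof -
      obtain l z where z: "x < z" "z < y" "((\<lambda>x. x powr b) has_real_derivative l) (at z)"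
        "y powr b - x powr b = (y - x) * l"
        using MVT[OF \<open>x < y\<close> c[OF \<open>0 \<le> x\<close>]] dv \<open>0 \<le> x\<close>
        by (metis le_less_trans real_differentiable_def)
      have "l = b * z powr (b - 1)"
        using z(3) dv[of z] DERIV_unique z(1) \<open>0 \<le> x\<close> by (metis le_less_trans)
      with z show ?thesis by auto
    qed
    obtain z1 where z1: "u < z1" "z1 < m" "m powr b - u powr b = (m - u) * (b * z1 powr (b - 1))"
      using mv[of u m] uv m by auto
    obtain z2 where z2: "m < z2" "z2 < v" "v powr b - m powr b = (v - m) * (b * z2 powr (b - 1))"
      using mv[of m v] uv m by auto
    have "z1 powr (b - 1) < z2 powr (b - 1)"
      using z1 z2 uv assms(1) by (intro powr_less_mono2) auto
    then have "b * z1 powr (b - 1) < b * z2 powr (b - 1)" using assms(1) by simp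
    then have "(m - u) * (b * z1 powr (b - 1)) < (m - u) * (b * z2 powr (b - 1))" using m by simp
    also have "m - u = v - m" by (simp add: m_def field_simps)
    finally show ?thesis using z1(3) z2(3) \<open>m - u = v - m\<close> by (simp add: m_def[symmetric])
  qed
  show ?thesis
    using *[of u v] *[of v u] assms by (cases "u < v") (auto simp: add.commute)
qed

text \<open>Strict convexity on the half-line settles the case of different absolute values; if
  \<open>y = - x\<close> is nonzero, the left side is 0 and the right side positive.\<close>

lemma abs_powr_midpoint:
  fixes x y b :: real
  assumes "1 < b"
  shows "\<bar>(x + y) / 2\<bar> powr b \<le> (\<bar>x\<bar> powr b + \<bar>y\<bar> powr b) / 2"
    and "\<bar>(x + y) / 2\<bar> powr b = (\<bar>x\<bar> powr b + \<bar>y\<bar> powr b) / 2 \<Longrightarrow> x = y"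
proof -
  have "\<bar>(x + y) / 2\<bar> powr b < (\<bar>x\<bar> powr b + \<bar>y\<bar> powr b) / 2" if "x \<noteq> y"
  proof (cases "\<bar>x\<bar> = \<bar>y\<bar>")
    case False
    have "\<bar>(x + y) / 2\<bar> powr b \<le> ((\<bar>x\<bar> + \<bar>y\<bar>) / 2) powr b"
      using assms by (intro powr_mono2) auto
    also have "\<dots> < (\<bar>x\<bar> powr b + \<bar>y\<bar> powr b) / 2"
      using assms False by (intro powr_midpoint_strict) auto
    finally show ?thesis .
  next
    case True
    with that have "y = - x" "x \<noteq> 0" by auto
    then show ?thesis by simp
  qed
  then show "\<bar>(x + y) / 2\<bar> powr b \<le> (\<bar>x\<bar> powr b + \<bar>y\<bar> powr b) / 2"
    and "\<bar>(x + y) / 2\<bar> powr b = (\<bar>x\<bar> powr b + \<bar>y\<bar> powr b) / 2 \<Longrightarrow> x = y"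
    by (cases "x = y"; force)+
qed

text \<open>Convexity for the exponent \<open>1 / p > 1\<close>, applied to \<open>u powr p\<close>
  and \<open>v powr p\<close>, then raised to the power \<open>p\<close>.\<close>

lemma powr_midpoint_concave:
  fixes u v p :: real
  assumes "0 < p" "p < 1" "0 \<le> u" "0 \<le> v"
  shows "(u powr p + v powr p) / 2 \<le> ((u + v) / 2) powr p"
proof -
  have "((u powr p + v powr p) / 2) powr (1 / p) \<le> ((u powr p) powr (1/p) + (v powr p) powr (1/p)) / 2"
    using abs_powr_midpoint(1)[of "1/p" "u powr p" "v powr p"] assms by simp
  also have "\<dots> = (u + v) / 2" using assms by (simp add: powr_powr)
  finally have "(((u powr p + v powr p) / 2) powr (1 / p)) powr p \<le> ((u + v) / 2) powr p"
    using assms by (intro powr_mono2) auto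
  then show ?thesis using assms by (simp add: powr_powr)
qed

lemma powr_superadditive:
  fixes x y p :: real
  assumes "1 < p" "0 < x" "0 < y"
  shows "x powr p + y powr p < (x + y) powr p"
proof -
  have e: "z powr p = z * z powr (p - 1)" if "0 < z" for z :: real
    using that by (simp add: powr_mult_base)
  have "x powr (p - 1) < (x + y) powr (p - 1)" "y powr (p - 1) < (x + y) powr (p - 1)"
    using assms by (auto intro!: powr_less_mono2)
  then have "x * x powr (p - 1) + y * y powr (p - 1) < x * (x + y) powr (p - 1) + y * (x + y) powr (p - 1)"
    using assms by (intro add_strict_mono mult_strict_left_mono) auto
  then show ?thesis using assms by (simp add: e ring_distribs del: powr_mult_base)
qed

lemma powr_subadditive:
  fixes x y p :: real
  assumes "0 < p" "p < 1" "0 < x" "0 < y"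
  shows "(x + y) powr p < x powr p + y powr p"
proof -
  have "(x powr p) powr (1/p) + (y powr p) powr (1/p) < (x powr p + y powr p) powr (1/p)"
    using assms by (intro powr_superadditive) auto
  then have "(x + y) powr p < ((x powr p + y powr p) powr (1/p)) powr p"
    using assms by (intro powr_less_mono2) (auto simp: powr_powr)
  then show ?thesis using assms by (simp add: powr_powr)
qed

section \<open>Lamperti's inequality on either side of the exponent 2\<close>

lemma abs_powr_square: "\<bar>x\<bar> powr b = (x\<^sup>2) powr (b / 2)" for x b :: real
proof (cases "x = 0")
  case False
  have "(x\<^sup>2) powr (b / 2) = (\<bar>x\<bar> powr 2) powr (b / 2)" using False by simp
  then show ?thesis unfolding powr_powr by simp
qed simp

text \<open>The squares of \<open>x + y\<close> and \<open>x - y\<close> have mean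
  \<open>x^2 + y^2\<close>. Convexity of the power \<open>b / 2 > 1\<close> bounds the right side
  below by \<open>2 * (x^2 + y^2) powr (b / 2)\<close>, and superadditivity, strict for nonzero
  \<open>x\<close> and \<open>y\<close>, compares this with the left side.\<close>

lemma Lamperti_greater_2:
  fixes x y b :: real
  assumes "2 < b"
  shows "2 * (\<bar>x\<bar> powr b + \<bar>y\<bar> powr b) \<le> \<bar>x + y\<bar> powr b + \<bar>x - y\<bar> powr b"
    and "2 * (\<bar>x\<bar> powr b + \<bar>y\<bar> powr b) = \<bar>x + y\<bar> powr b + \<bar>x - y\<bar> powr b \<Longrightarrow> x = 0 \<or> y = 0"
proof -
  have e: "((x + y)\<^sup>2 + (x - y)\<^sup>2) / 2 = x\<^sup>2 + y\<^sup>2" by (simp add: power2_sum power2_diff)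
  define p where "p = b / 2"
  have p: "1 < p" using assms by (simp add: p_def)
  have "2 * (x\<^sup>2 + y\<^sup>2) powr p \<le> \<bar>x + y\<bar> powr b + \<bar>x - y\<bar> powr b"
    using abs_powr_midpoint(1)[OF p, of "(x + y)\<^sup>2" "(x - y)\<^sup>2"]
    by (simp add: abs_powr_square[of _ b] p_def[symmetric] e)
  moreover have "(x\<^sup>2) powr p + (y\<^sup>2) powr p < (x\<^sup>2 + y\<^sup>2) powr p" if "x \<noteq> 0" "y \<noteq> 0"
    using that p by (intro powr_superadditive) auto
  ultimately have "2 * (\<bar>x\<bar> powr b + \<bar>y\<bar> powr b) < \<bar>x + y\<bar> powr b + \<bar>x - y\<bar> powr b" if "x \<noteq> 0" "y \<noteq> 0"
    using that by (force simp: abs_powr_square[of x b] abs_powr_square[of y b] p_def[symmetric])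
  then show "2 * (\<bar>x\<bar> powr b + \<bar>y\<bar> powr b) \<le> \<bar>x + y\<bar> powr b + \<bar>x - y\<bar> powr b"
    and "2 * (\<bar>x\<bar> powr b + \<bar>y\<bar> powr b) = \<bar>x + y\<bar> powr b + \<bar>x - y\<bar> powr b \<Longrightarrow> x = 0 \<or> y = 0"
    by (cases "x = 0 \<or> y = 0"; force)+
qed

text \<open>The exponent \<open>b / 2\<close> is now below 1, so concavity and subadditivity reverse
  both steps. At \<open>b = 2\<close> the parallelogram law gives equality for all \<open>x\<close>
  and \<open>y\<close>, and nothing could be concluded from it.\<close>

lemma Lamperti_less_2:
  fixes x y b :: real
  assumes "0 < b" "b < 2"
  shows "\<bar>x + y\<bar> powr b + \<bar>x - y\<bar> powr b \<le> 2 * (\<bar>x\<bar> powr b + \<bar>y\<bar> powr b)"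
    and "\<bar>x + y\<bar> powr b + \<bar>x - y\<bar> powr b = 2 * (\<bar>x\<bar> powr b + \<bar>y\<bar> powr b) \<Longrightarrow> x = 0 \<or> y = 0"
proof -
  have e: "((x + y)\<^sup>2 + (x - y)\<^sup>2) / 2 = x\<^sup>2 + y\<^sup>2" by (simp add: power2_sum power2_diff)
  define p where "p = b / 2"
  have p: "0 < p" "p < 1" using assms by (simp_all add: p_def)
  have "\<bar>x + y\<bar> powr b + \<bar>x - y\<bar> powr b \<le> 2 * (x\<^sup>2 + y\<^sup>2) powr p"
    using powr_midpoint_concave[OF p, of "(x + y)\<^sup>2" "(x - y)\<^sup>2"]
    by (simp add: abs_powr_square[of _ b] p_def[symmetric] e)
  moreover have "(x\<^sup>2 + y\<^sup>2) powr p < (x\<^sup>2) powr p + (y\<^sup>2) powr p" if "x \<noteq> 0" "y \<noteq> 0"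
    using that p by (intro powr_subadditive) auto
  ultimately have "\<bar>x + y\<bar> powr b + \<bar>x - y\<bar> powr b < 2 * (\<bar>x\<bar> powr b + \<bar>y\<bar> powr b)" if "x \<noteq> 0" "y \<noteq> 0"
    using that by (force simp: abs_powr_square[of x b] abs_powr_square[of y b] p_def[symmetric])
  then show "\<bar>x + y\<bar> powr b + \<bar>x - y\<bar> powr b \<le> 2 * (\<bar>x\<bar> powr b + \<bar>y\<bar> powr b)"
    and "\<bar>x + y\<bar> powr b + \<bar>x - y\<bar> powr b = 2 * (\<bar>x\<bar> powr b + \<bar>y\<bar> powr b) \<Longrightarrow> x = 0 \<or> y = 0"
    by (cases "x = 0 \<or> y = 0"; force)+
qed

section \<open>Exponents at most 1: powers of the distance as a metric\<close>

lemma abs_powr_triangle: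
  fixes x y z b :: real
  assumes "0 < b" "b \<le> 1"
  shows "\<bar>x - z\<bar> powr b \<le> \<bar>x - y\<bar> powr b + \<bar>y - z\<bar> powr b"
proof (cases "b = 1 \<or> x = y \<or> y = z")
  case True
  then show ?thesis by auto
next
  case False
  have "\<bar>x - z\<bar> powr b \<le> (\<bar>x - y\<bar> + \<bar>y - z\<bar>) powr b"
    using assms by (intro powr_mono2) auto
  also have "\<dots> < \<bar>x - y\<bar> powr b + \<bar>y - z\<bar> powr b"
    using assms False by (intro powr_subadditive) auto
  finally show ?thesis by simp
qed

text \<open>Each diagonal is bounded by two adjacent sides in two ways, and the sum of these four
  triangle inequalities is twice the claim. Equality makes all four sharp, so no side is longer than
  a diagonal; on the line only the stated degenerate quadrilaterals have this property.\<close>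

lemma quadrilateral_powr_le_1:
  fixes w x y z b :: real
  assumes b: "0 < b" "b \<le> 1"
  shows "\<bar>w - y\<bar> powr b + \<bar>x - z\<bar> powr b \<le>
      \<bar>w - x\<bar> powr b + \<bar>x - y\<bar> powr b + \<bar>y - z\<bar> powr b + \<bar>z - w\<bar> powr b"
    and "\<bar>w - y\<bar> powr b + \<bar>x - z\<bar> powr b =
      \<bar>w - x\<bar> powr b + \<bar>x - y\<bar> powr b + \<bar>y - z\<bar> powr b + \<bar>z - w\<bar> powr b \<Longrightarrow>
      (w = x \<and> z = y) \<or> (w = z \<and> x = y)"
proof -
  note t = abs_powr_triangle[OF b]
  have c: "\<bar>u - v\<bar> powr b = \<bar>v - u\<bar> powr b" for u v :: real by (simp add: abs_minus_commute)
  have tr: "\<bar>w - y\<bar> powr b \<le> \<bar>w - x\<bar> powr b + \<bar>x - y\<bar> powr b"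
    "\<bar>w - y\<bar> powr b \<le> \<bar>y - z\<bar> powr b + \<bar>z - w\<bar> powr b"
    "\<bar>x - z\<bar> powr b \<le> \<bar>w - x\<bar> powr b + \<bar>z - w\<bar> powr b"
    "\<bar>x - z\<bar> powr b \<le> \<bar>x - y\<bar> powr b + \<bar>y - z\<bar> powr b"
    using t[of w y x] t[of y w z] t[of x z w] t[of x z y] c by (smt (verit))+
  show "\<bar>w - y\<bar> powr b + \<bar>x - z\<bar> powr b \<le>
      \<bar>w - x\<bar> powr b + \<bar>x - y\<bar> powr b + \<bar>y - z\<bar> powr b + \<bar>z - w\<bar> powr b"
    using tr by linarith
  assume eq: "\<bar>w - y\<bar> powr b + \<bar>x - z\<bar> powr b =
      \<bar>w - x\<bar> powr b + \<bar>x - y\<bar> powr b + \<bar>y - z\<bar> powr b + \<bar>z - w\<bar> powr b"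
  have m: "\<bar>u\<bar> \<le> \<bar>v\<bar>" if "\<bar>u\<bar> powr b \<le> \<bar>v\<bar> powr b" for u v :: real
    using that b powr_less_mono2[of b "\<bar>v\<bar>" "\<bar>u\<bar>"] by (cases "\<bar>u\<bar> \<le> \<bar>v\<bar>") auto
  have "\<bar>u\<bar> powr b \<ge> 0" for u :: real by simp
  then have "\<bar>w - x\<bar> \<le> \<bar>w - y\<bar>" "\<bar>x - y\<bar> \<le> \<bar>w - y\<bar>" "\<bar>y - z\<bar> \<le> \<bar>w - y\<bar>" "\<bar>z - w\<bar> \<le> \<bar>w - y\<bar>"
    "\<bar>w - x\<bar> \<le> \<bar>x - z\<bar>" "\<bar>x - y\<bar> \<le> \<bar>x - z\<bar>" "\<bar>y - z\<bar> \<le> \<bar>x - z\<bar>" "\<bar>z - w\<bar> \<le> \<bar>x - z\<bar>"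
    using eq tr by (smt (verit) m)+
  then show "(w = x \<and> z = y) \<or> (w = z \<and> x = y)" by linarith
qed

section \<open>Isometries\<close>

lemma scaled_dist_abs:
  assumes "\<And>i. 0 < \<sigma> i"
  shows "scaled_dist \<sigma> \<beta> s t = (\<Sum>i\<in>UNIV. \<bar>s $ i / \<sigma> i - t $ i / \<sigma> i\<bar> powr \<beta>)"
  using assms by (simp add: scaled_dist_def diff_divide_distrib[symmetric] less_imp_le)

lemma scaled_dist_commute: "scaled_dist \<sigma> \<beta> s t = scaled_dist \<sigma> \<beta> t s"
  by (simp add: scaled_dist_def abs_minus_commute)

lemma scaled_dist_self [simp]: "scaled_dist \<sigma> \<beta> s s = 0"
  by (simp add: scaled_dist_def)

lemma scaled_dist_nonneg: "0 \<le> scaled_dist \<sigma> \<beta> s t"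
  by (simp add: scaled_dist_def sum_nonneg)

lemma coord_le_scaled_dist:
  assumes "0 < \<beta>" "\<And>i. 0 < \<sigma> i"
  shows "\<bar>s $ i - t $ i\<bar> \<le> \<sigma> i * scaled_dist \<sigma> \<beta> s t powr (1 / \<beta>)"
proof -
  have "(\<bar>s $ i - t $ i\<bar> / \<sigma> i) powr \<beta> \<le> scaled_dist \<sigma> \<beta> s t"
    unfolding scaled_dist_def by (rule member_le_sum) auto
  then have "((\<bar>s $ i - t $ i\<bar> / \<sigma> i) powr \<beta>) powr (1 / \<beta>) \<le> scaled_dist \<sigma> \<beta> s t powr (1 / \<beta>)"
    using assms by (intro powr_mono2) auto
  then show ?thesis
    using assms(1) assms(2)[of i] by (simp add: powr_powr field_simps)
qed

lemma scaled_dist_eq_0_iff: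
  assumes "0 < \<beta>" "\<And>i. 0 < \<sigma> i"
  shows "scaled_dist \<sigma> \<beta> s t = 0 \<longleftrightarrow> s = t"
proof
  assume "scaled_dist \<sigma> \<beta> s t = 0"
  then show "s = t" using coord_le_scaled_dist[where \<sigma> = \<sigma>, OF assms, of s _ t] by (simp add: vec_eq_iff)
qed simp

lemma continuous_on_scaled_dist:
  fixes f g :: "'a::topological_space \<Rightarrow> real^'n"
  assumes "0 < \<beta>" "\<And>i. 0 < \<sigma> i" "continuous_on A f" "continuous_on A g"
  shows "continuous_on A (\<lambda>x. scaled_dist \<sigma> \<beta> (f x) (g x))"
  unfolding scaled_dist_def
  by (intro continuous_on_sum continuous_on_powr' continuous_intros assms)
     (use assms in \<open>auto simp: less_imp_le less_imp_neq[symmetric]\<close>)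

text \<open>For \<beta> > 1 strict convexity in every coordinate makes the midpoint the only
  \<open>z\<close> that minimizes the sum of the distances to \<open>x\<close> and \<open>y\<close>.
  The minimum is the distance of \<open>x\<close> and \<open>y\<close> times
  \<open>2 / 2 powr \<beta>\<close>, a condition that a distance preserving map hands on to the
  image.\<close>

lemma scaled_dist_midpoint_isometry:
  fixes h :: "real^'n \<Rightarrow> real^'n"
  assumes \<beta>: "1 < \<beta>" and \<sigma>: "\<And>i. 0 < \<sigma> i"
    and h: "\<And>s t. s \<in> C \<Longrightarrow> t \<in> C \<Longrightarrow> scaled_dist \<sigma> \<beta> (h s) (h t) = scaled_dist \<sigma> \<beta> s t"
    and x: "x \<in> C" and y: "y \<in> C" and m: "midpoint x y \<in> C"
  shows "h x + h y = 2 *\<^sub>R h (midpoint x y)"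
proof -
  let ?m = "midpoint x y"
  define T where "T u v i = \<bar>u $ i / \<sigma> i - v $ i / \<sigma> i\<bar> powr \<beta>" for u v :: "real^'n" and i
  have D: "scaled_dist \<sigma> \<beta> u v = (\<Sum>i\<in>UNIV. T u v i)" for u v
    unfolding T_def by (rule scaled_dist_abs[OF \<sigma>])
  have hT: "(\<Sum>i\<in>UNIV. T (h u) (h v) i) = (\<Sum>i\<in>UNIV. T u v i)" if "u \<in> C" "v \<in> C" for u v
    using h[OF that] unfolding D .
  have half: "\<bar>u / 2\<bar> powr \<beta> = \<bar>u\<bar> powr \<beta> / 2 powr \<beta>" for u :: real
    by (simp add: powr_divide)
  have T1: "T x ?m i = T x y i / 2 powr \<beta>" "T ?m y i = T x y i / 2 powr \<beta>" for i
    unfolding T_def half[symmetric] midpoint_def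
    by (rule arg_cong[where f = "\<lambda>u. \<bar>u\<bar> powr \<beta>"], use \<sigma>[of i] in \<open>simp add: field_simps\<close>)+
  have le: "T (h x) (h y) i / 2 powr \<beta> \<le> (T (h x) (h ?m) i + T (h ?m) (h y) i) / 2" for i
    using abs_powr_midpoint(1)[OF \<beta>, of "h x $ i / \<sigma> i - h ?m $ i / \<sigma> i" "h ?m $ i / \<sigma> i - h y $ i / \<sigma> i"]
    unfolding T_def half by simp
  have "(\<Sum>i\<in>UNIV. T (h x) (h y) i / 2 powr \<beta>) = scaled_dist \<sigma> \<beta> x y / 2 powr \<beta>"
    by (simp add: hT x y D flip: sum_divide_distrib)
  also have "\<dots> = (scaled_dist \<sigma> \<beta> x ?m + scaled_dist \<sigma> \<beta> ?m y) / 2"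
    by (simp add: D T1 flip: sum_divide_distrib)
  also have "\<dots> = (\<Sum>i\<in>UNIV. (T (h x) (h ?m) i + T (h ?m) (h y) i) / 2)"
    by (simp add: hT x y m D sum.distrib flip: sum_divide_distrib)
  finally have sum_eq: "(\<Sum>i\<in>UNIV. T (h x) (h y) i / 2 powr \<beta>) =
    (\<Sum>i\<in>UNIV. (T (h x) (h ?m) i + T (h ?m) (h y) i) / 2)" .
  have "h x $ i + h y $ i = 2 * h ?m $ i" for i
  proof -
    have "T (h x) (h y) i / 2 powr \<beta> = (T (h x) (h ?m) i + T (h ?m) (h y) i) / 2"
      by (rule sum_mono_inv[OF sum_eq]) (use le in auto)
    then have "h x $ i / \<sigma> i - h ?m $ i / \<sigma> i = h ?m $ i / \<sigma> i - h y $ i / \<sigma> i"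
      using abs_powr_midpoint(2)[OF \<beta>, of "h x $ i / \<sigma> i - h ?m $ i / \<sigma> i" "h ?m $ i / \<sigma> i - h y $ i / \<sigma> i"]
      unfolding T_def half by simp
    then show ?thesis using \<sigma>[of i] by (simp add: field_simps)
  qed
  then show ?thesis by (simp add: vec_eq_iff)
qed

text \<open>Every coordinate of the rectangle is degenerate, so its diagonals and its sides have the
  same total distance. This equality of totals survives under \<open>h\<close>, while in the image
  each coordinate satisfies an inequality; summation leaves equality in every coordinate.\<close>

lemma scaled_dist_rectangle_isometry:
  fixes h :: "real^'n \<Rightarrow> real^'n"
  assumes \<beta>: "\<beta> \<in> {0<..<2} \<union> {2<..}" and \<sigma>: "\<And>i. 0 < \<sigma> i" and C: "convex C"
    and h: "\<And>s t. s \<in> C \<Longrightarrow> t \<in> C \<Longrightarrow> scaled_dist \<sigma> \<beta> (h s) (h t) = scaled_dist \<sigma> \<beta> s t"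
    and C4: "w \<in> C" "x \<in> C" "y \<in> C" "z \<in> C"
    and rect: "\<And>i. (w $ i = x $ i \<and> z $ i = y $ i) \<or> (w $ i = z $ i \<and> x $ i = y $ i)"
  shows "(h w $ k = h x $ k \<and> h z $ k = h y $ k) \<or> (h w $ k = h z $ k \<and> h x $ k = h y $ k)"
proof -
  define T where "T u v i = \<bar>u $ i / \<sigma> i - v $ i / \<sigma> i\<bar> powr \<beta>" for u v :: "real^'n" and i
  have D: "scaled_dist \<sigma> \<beta> u v = (\<Sum>i\<in>UNIV. T u v i)" for u v
    unfolding T_def by (rule scaled_dist_abs[OF \<sigma>])
  have hT: "(\<Sum>i\<in>UNIV. T (h u) (h v) i) = (\<Sum>i\<in>UNIV. T u v i)" if "u \<in> C" "v \<in> C" for u v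
    using h[OF that] unfolding D .
  have T0: "T w y i + T x z i = T w x i + T x y i + T y z i + T z w i" for i
    using rect[of i] \<beta> by (auto simp: T_def abs_minus_commute)
  have "scaled_dist \<sigma> \<beta> w y + scaled_dist \<sigma> \<beta> x z =
      scaled_dist \<sigma> \<beta> w x + scaled_dist \<sigma> \<beta> x y + scaled_dist \<sigma> \<beta> y z + scaled_dist \<sigma> \<beta> z w"
    unfolding D sum.distrib[symmetric] T0 ..
  then have sum_eq: "(\<Sum>i\<in>UNIV. T (h w) (h y) i + T (h x) (h z) i) =
      (\<Sum>i\<in>UNIV. T (h w) (h x) i + T (h x) (h y) i + T (h y) (h z) i + T (h z) (h w) i)"
    unfolding D sum.distrib using C4 by (simp add: hT)
  \<comment> \<open>The diagonals of the rectangle share their midpoint, so the image is a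
    parallelogram. With its edges \<open>u\<close> and \<open>v\<close>, diagonals and sides become
    the two sides of Lamperti's inequality.\<close>
  have par: "h w $ i + h y $ i = h x $ i + h z $ i" if "1 < \<beta>" for i
  proof -
    have "w $ i + y $ i = x $ i + z $ i" for i using rect[of i] by auto
    then have "midpoint w y = midpoint x z" by (simp add: midpoint_def vec_eq_iff)
    moreover have "midpoint w y \<in> C" using C C4 midpoint_in_closed_segment convex_contains_segment by blast
    ultimately have "h w + h y = h x + h z"
      using scaled_dist_midpoint_isometry[OF that \<sigma> h, of C w y] scaled_dist_midpoint_isometry[OF that \<sigma> h, of C x z] C4
      by auto
    then show ?thesis by (metis vector_add_component)
  qed
  let ?L = "\<lambda>i. T (h w) (h y) i + T (h x) (h z) i"
  let ?R = "\<lambda>i. T (h w) (h x) i + T (h x) (h y) i + T (h y) (h z) i + T (h z) (h w) i"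
  have scale: "a / \<sigma> i = b / \<sigma> i \<longleftrightarrow> a = b" for a b i using \<sigma>[of i] by simp
  define u v where "u i = h x $ i / \<sigma> i - h w $ i / \<sigma> i" and "v i = h z $ i / \<sigma> i - h w $ i / \<sigma> i" for i
  have e: "?L i = \<bar>u i + v i\<bar> powr \<beta> + \<bar>u i - v i\<bar> powr \<beta>" "?R i = 2 * (\<bar>u i\<bar> powr \<beta> + \<bar>v i\<bar> powr \<beta>)"
    if "1 < \<beta>" for i
  proof -
    have "h y $ i = h x $ i + h z $ i - h w $ i" using par[OF that, of i] by simp
    then have "h y $ i / \<sigma> i = h x $ i / \<sigma> i + h z $ i / \<sigma> i - h w $ i / \<sigma> i"
      by (simp add: diff_divide_distrib add_divide_distrib)
    then have "h w $ i / \<sigma> i - h y $ i / \<sigma> i = - (u i + v i)" "h x $ i / \<sigma> i - h z $ i / \<sigma> i = u i - v i"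
      "h w $ i / \<sigma> i - h x $ i / \<sigma> i = - u i" "h x $ i / \<sigma> i - h y $ i / \<sigma> i = - v i"
      "h y $ i / \<sigma> i - h z $ i / \<sigma> i = u i" "h z $ i / \<sigma> i - h w $ i / \<sigma> i = v i"
      by (simp_all add: u_def v_def)
    then show "?L i = \<bar>u i + v i\<bar> powr \<beta> + \<bar>u i - v i\<bar> powr \<beta>" "?R i = 2 * (\<bar>u i\<bar> powr \<beta> + \<bar>v i\<bar> powr \<beta>)"
      unfolding T_def by (simp_all only: abs_minus_cancel) simp
  qed
  have degen: "(h w $ k = h x $ k \<and> h z $ k = h y $ k) \<or> (h w $ k = h z $ k \<and> h x $ k = h y $ k)"
    if "1 < \<beta>" "u k = 0 \<or> v k = 0"
    using par[OF that(1), of k] that(2) \<sigma>[of k] by (auto simp: u_def v_def scale)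
  consider "0 < \<beta>" "\<beta> \<le> 1" | "1 < \<beta>" "\<beta> < 2" | "2 < \<beta>" using \<beta> by force
  \<comment> \<open>The direction of the inequality depends on \<beta> but not on the coordinate,
    which is all that comparing the sums requires.\<close>
  then have "((\<forall>i. ?L i \<le> ?R i) \<or> (\<forall>i. ?R i \<le> ?L i)) \<and>
     (?L k = ?R k \<longrightarrow> (h w $ k = h x $ k \<and> h z $ k = h y $ k) \<or> (h w $ k = h z $ k \<and> h x $ k = h y $ k))"
  proof cases
    case 1
    have "?L i \<le> ?R i" for i
      unfolding T_def by (rule quadrilateral_powr_le_1(1)[OF 1])
    moreover have "(h w $ k / \<sigma> k = h x $ k / \<sigma> k \<and> h z $ k / \<sigma> k = h y $ k / \<sigma> k) \<or>
        (h w $ k / \<sigma> k = h z $ k / \<sigma> k \<and> h x $ k / \<sigma> k = h y $ k / \<sigma> k)" if "?L k = ?R k"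
      by (rule quadrilateral_powr_le_1(2)[OF 1 that[unfolded T_def]])
    ultimately show ?thesis unfolding scale by blast
  next
    case 2
    then have b: "1 < \<beta>" "0 < \<beta>" "\<beta> < 2" by auto
    have "?L i \<le> ?R i" for i
      unfolding e[OF b(1)] by (rule Lamperti_less_2(1)[OF b(2,3)])
    moreover have "u k = 0 \<or> v k = 0" if "?L k = ?R k"
      by (rule Lamperti_less_2(2)[OF b(2,3) that[unfolded e[OF b(1)]]])
    ultimately show ?thesis using degen[OF b(1)] by blast
  next
    case 3
    then have b: "1 < \<beta>" "2 < \<beta>" by auto
    have "?R i \<le> ?L i" for i
      unfolding e[OF b(1)] by (rule Lamperti_greater_2(1)[OF b(2)])
    moreover have "u k = 0 \<or> v k = 0" if "?L k = ?R k"
      by (rule Lamperti_greater_2(2)[OF b(2) that[symmetric, unfolded e[OF b(1)]]])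
    ultimately show ?thesis using degen[OF b(1)] by blast
  qed
  moreover have "?L k = ?R k" if "\<forall>i. ?L i \<le> ?R i"
    by (rule sum_mono_inv[OF sum_eq]) (use that in auto)
  moreover have "?L k = ?R k" if "\<forall>i. ?R i \<le> ?L i"
    by (rule sum_mono_inv[OF sum_eq[symmetric], symmetric]) (use that in auto)
  ultimately show ?thesis by blast
qed

section \<open>Isometries of a cube\<close>

lemma real_isometry_interval:
  fixes \<phi> :: "real \<Rightarrow> real"
  assumes r: "0 < r" and iso: "\<And>x y. \<bar>x\<bar> < r \<Longrightarrow> \<bar>y\<bar> < r \<Longrightarrow> \<bar>\<phi> x - \<phi> y\<bar> = \<bar>x - y\<bar>"
  shows "\<exists>e. \<bar>e\<bar> = 1 \<and> (\<forall>x. \<bar>x\<bar> < r \<longrightarrow> \<phi> x = \<phi> 0 + e * x)"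
proof -
  \<comment> \<open>The slope between the reference points 0 and \<open>r/2\<close>, which is 1 or
    -1. The distances to these two points determine every other value.\<close>
  define e where "e = (\<phi> (r/2) - \<phi> 0) / (r/2)"
  have a: "\<bar>\<phi> (r/2) - \<phi> 0\<bar> = r/2" using iso[of "r/2" 0] r by simp
  have e: "e = 1 \<or> e = -1"
  proof -
    have "\<phi> (r/2) - \<phi> 0 = r/2 \<or> \<phi> (r/2) - \<phi> 0 = - (r/2)" using a by linarith
    then show ?thesis unfolding e_def using r by (elim disjE) simp_all
  qed
  have "\<phi> x = \<phi> 0 + e * x" if "\<bar>x\<bar> < r" for x
  proof -
    define a where "a = \<phi> x - \<phi> 0"
    have e2: "e * e = 1" using e by (elim disjE) simp_all
    have er: "e * (r/2) = \<phi> (r/2) - \<phi> 0" using r by (simp add: e_def)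
    have "a - e * (r/2) = \<phi> x - \<phi> (r/2)" unfolding er a_def by simp
    then have "\<bar>a\<bar> = \<bar>x\<bar>" "\<bar>a - e * (r/2)\<bar> = \<bar>x - r/2\<bar>"
      using iso[of x 0] iso[of x "r/2"] that r by (simp_all add: a_def)
    then have "a\<^sup>2 = x\<^sup>2" "(a - e * (r/2))\<^sup>2 = (x - r/2)\<^sup>2" unfolding power2_eq_iff abs_eq_iff .
    moreover have "(e * (r/2))\<^sup>2 = (r/2)\<^sup>2" using e by (elim disjE) simp_all
    \<comment> \<open>Comparing the squared distances to both reference points cancels the squares
      and leaves an equation linear in \<open>a\<close>.\<close>
    ultimately have "2 * a * (e * (r/2)) = 2 * x * (r/2)" unfolding power2_diff by linarith
    then have "r * (e * a) = r * x" by (simp add: ac_simps)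
    then have "e * (e * a) = e * x" using r by simp
    then show ?thesis using e2 by (simp add: a_def flip: mult.assoc)
  qed
  moreover have "\<bar>e\<bar> = 1" using e by (elim disjE) simp_all
  ultimately show ?thesis by blast
qed

lemma matrix_vector_mult_generalized_permutation:
  fixes c :: "'n::finite \<Rightarrow> real" and \<pi> :: "'n \<Rightarrow> 'n"
  shows "((\<chi> i j. if j = \<pi> i then c i else 0) *v x) $ i = c i * x $ \<pi> i"
proof -
  have "((\<chi> i j. if j = \<pi> i then c i else 0) *v x) $ i = (\<Sum>j\<in>UNIV. if j = \<pi> i then c i * x $ j else 0)"
    unfolding matrix_vector_mult_def by (simp add: if_distrib[where f = "\<lambda>u. u * _"] cong: if_cong)
  then show ?thesis by simp
qed

text \<open>Moves along the axes through \<open>p\<close> serve as probes. Moving coordinate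
  \<open>i\<close> changes some coordinate \<pi> \<open>i\<close> of \<open>h\<close>; rectangles
  show that \<pi> is injective and that this output depends on input \<open>i\<close> alone. Along
  each axis \<open>h\<close> is then a one-dimensional isometry up to the scales \<sigma>.\<close>

lemma scaled_dist_isometry_cube:
  fixes h :: "real^'n \<Rightarrow> real^'n" and p :: "real^'n"
  assumes \<beta>: "\<beta> \<in> {0<..<2} \<union> {2<..}" and \<sigma>: "\<And>i. 0 < \<sigma> i" and r: "0 < r"
    and C_def: "C = {s. \<forall>i. \<bar>s $ i - p $ i\<bar> < r}"
    and h: "\<And>s t. s \<in> C \<Longrightarrow> t \<in> C \<Longrightarrow> scaled_dist \<sigma> \<beta> (h s) (h t) = scaled_dist \<sigma> \<beta> s t"
  shows "\<exists>A b. generalized_permutation A \<and> (\<forall>s\<in>C. h s = A *v s + b)"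
proof -
  have \<beta>0: "0 < \<beta>" using \<beta> by auto
  have "C = box (p - (\<chi> i. r)) (p + (\<chi> i. r))"
    unfolding C_def by (auto simp: mem_box_cart abs_less_iff algebra_simps)
  then have C: "convex C" by simp
  have p: "p \<in> C" using r by (simp add: C_def)
  \<comment> \<open>\<open>x\<close> and \<open>y\<close> move \<open>p\<close> in disjoint sets of coordinates, \<open>z\<close> makes both moves\<close>
  have rect: "(h p $ k = h x $ k \<and> h y $ k = h z $ k) \<or> (h p $ k = h y $ k \<and> h x $ k = h z $ k)"
    if "x \<in> C" "y \<in> C" "z \<in> C"
      "\<And>i. (x $ i = p $ i \<and> z $ i = y $ i) \<or> (y $ i = p $ i \<and> z $ i = x $ i)" for x y z k
  proof (rule scaled_dist_rectangle_isometry[OF \<beta> \<sigma> C h p that(1,3,2)])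
    show "(p $ i = x $ i \<and> y $ i = z $ i) \<or> (p $ i = y $ i \<and> x $ i = z $ i)" for i
      using that(4)[of i] by metis
  qed
  define ax where "ax i t = (\<chi> j. if j = i then p $ i + t else p $ j)" for i t
  have ax: "ax i t \<in> C" if "\<bar>t\<bar> < r" for i t using that r by (auto simp: C_def ax_def)
  have ax0: "ax i 0 = p" for i by (auto simp: ax_def vec_eq_iff)
  define \<eta> where "\<eta> = r / 2"
  have \<eta>: "0 < \<eta>" "\<bar>\<eta>\<bar> < r" using r by (auto simp: \<eta>_def)
  have "\<exists>k. h (ax i \<eta>) $ k \<noteq> h p $ k" for i
  proof -
    have "ax i \<eta> \<noteq> p" using \<eta> by (auto simp: ax_def vec_eq_iff)
    then have "scaled_dist \<sigma> \<beta> (h (ax i \<eta>)) (h p) \<noteq> 0"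
      using h[OF ax[OF \<eta>(2)] p] scaled_dist_eq_0_iff[OF \<beta>0, of \<sigma>] \<sigma> by simp
    then have "h (ax i \<eta>) \<noteq> h p" by auto
    then show ?thesis by (auto simp: vec_eq_iff)
  qed
  then obtain \<pi> where \<pi>: "\<And>i. h (ax i \<eta>) $ \<pi> i \<noteq> h p $ \<pi> i" by metis
  have "\<pi> i \<noteq> \<pi> j" if "i \<noteq> j" for i j
  proof -
    \<comment> \<open>The fourth corner of the rectangle spanned by both probes. An output
      coordinate can differ from its value at \<open>p\<close> along at most one of the two
      sides.\<close>
    let ?z = "\<chi> k. if k = i \<or> k = j then p $ k + \<eta> else p $ k"
    have "?z \<in> C" using \<eta> r by (auto simp: C_def)
    have "(h p $ k = h (ax i \<eta>) $ k \<and> h (ax j \<eta>) $ k = h ?z $ k) \<or> (h p $ k = h (ax j \<eta>) $ k \<and> h (ax i \<eta>) $ k = h ?z $ k)" for k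
      by (rule rect[OF ax[OF \<eta>(2)] ax[OF \<eta>(2)] \<open>?z \<in> C\<close>]) (use that in \<open>auto simp: ax_def\<close>)
    then show ?thesis using \<pi>[of i] \<pi>[of j] by metis
  qed
  then have inj: "inj \<pi>" by (auto simp: inj_def)
  then have "surj \<pi>" by (simp add: finite_UNIV_inj_surj)
  with inj have bij: "bij \<pi>" by (simp add: bij_def)
  have dep: "h w $ \<pi> i = h (ax i (w $ i - p $ i)) $ \<pi> i" if w: "w \<in> C" for w i
  proof -
    let ?x = "ax i (w $ i - p $ i)" and ?y = "\<chi> j. if j = i then p $ j else w $ j"
    \<comment> \<open>\<open>?z\<close> replaces the move of \<open>w\<close> in coordinate
      \<open>i\<close> by the probe \<open>\<eta>\<close>, which is known to change output
      \<open>\<pi> i\<close>. This excludes one alternative for its rectangle, so going from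
      \<open>p\<close> to \<open>?y\<close> leaves output \<open>\<pi> i\<close> unchanged; then
      both alternatives for the rectangle of \<open>w\<close> give the claim.\<close>
    let ?z = "\<chi> j. if j = i then p $ j + \<eta> else w $ j"
    have "?x \<in> C" using w by (intro ax) (auto simp: C_def)
    have "?y \<in> C" "?z \<in> C" using w r \<eta> by (auto simp: C_def)
    have 1: "(h p $ \<pi> i = h ?x $ \<pi> i \<and> h ?y $ \<pi> i = h w $ \<pi> i) \<or> (h p $ \<pi> i = h ?y $ \<pi> i \<and> h ?x $ \<pi> i = h w $ \<pi> i)"
      by (rule rect[OF \<open>?x \<in> C\<close> \<open>?y \<in> C\<close> w]) (auto simp: ax_def)
    have 2: "(h p $ \<pi> i = h (ax i \<eta>) $ \<pi> i \<and> h ?y $ \<pi> i = h ?z $ \<pi> i) \<or> (h p $ \<pi> i = h ?y $ \<pi> i \<and> h (ax i \<eta>) $ \<pi> i = h ?z $ \<pi> i)"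
      by (rule rect[OF ax[OF \<eta>(2)] \<open>?y \<in> C\<close> \<open>?z \<in> C\<close>]) (auto simp: ax_def)
    show ?thesis using 1 2 \<pi>[of i] by auto
  qed
  \<comment> \<open>Only output \<open>\<pi> i\<close> varies along axis \<open>i\<close>, so a
    single summand of \<open>scaled_dist\<close> is preserved there. The factor
    \<open>\<sigma> i / \<sigma> (\<pi> i)\<close> normalizes the slope to 1 or -1.\<close>
  have "\<exists>e. \<bar>e\<bar> = 1 \<and> (\<forall>t. \<bar>t\<bar> < r \<longrightarrow> h (ax i t) $ \<pi> i * (\<sigma> i / \<sigma> (\<pi> i)) =
      h (ax i 0) $ \<pi> i * (\<sigma> i / \<sigma> (\<pi> i)) + e * t)" for i
  proof (rule real_isometry_interval[OF r])
    fix t u :: real assume tu: "\<bar>t\<bar> < r" "\<bar>u\<bar> < r"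
    have other: "h (ax i t) $ k = h (ax i u) $ k" if "k \<noteq> \<pi> i" for k
    proof -
      obtain j where "k = \<pi> j" using \<open>surj \<pi>\<close> by (metis surjD)
      with that dep[OF ax[OF tu(1)], of i j] dep[OF ax[OF tu(2)], of i j] show ?thesis
        by (auto simp: ax_def)
    qed
    have "scaled_dist \<sigma> \<beta> (h (ax i t)) (h (ax i u)) =
        (\<Sum>k\<in>UNIV. if k = \<pi> i then (\<bar>h (ax i t) $ \<pi> i - h (ax i u) $ \<pi> i\<bar> / \<sigma> (\<pi> i)) powr \<beta> else 0)"
      unfolding scaled_dist_def by (rule sum.cong) (use other in auto)
    moreover have "scaled_dist \<sigma> \<beta> (ax i t) (ax i u) = (\<Sum>k\<in>UNIV. if k = i then (\<bar>t - u\<bar> / \<sigma> i) powr \<beta> else 0)"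
      unfolding scaled_dist_def by (rule sum.cong) (auto simp: ax_def)
    ultimately have eq: "(\<bar>h (ax i t) $ \<pi> i - h (ax i u) $ \<pi> i\<bar> / \<sigma> (\<pi> i)) powr \<beta> = (\<bar>t - u\<bar> / \<sigma> i) powr \<beta>"
      using h[OF ax[OF tu(1)] ax[OF tu(2)], of i i] by simp
    have "\<bar>h (ax i t) $ \<pi> i - h (ax i u) $ \<pi> i\<bar> / \<sigma> (\<pi> i) = \<bar>t - u\<bar> / \<sigma> i"
      using arg_cong[OF eq, of "\<lambda>u. u powr (1 / \<beta>)"] \<beta>0 \<sigma>[of i] \<sigma>[of "\<pi> i"] by (simp add: powr_powr)
    moreover have "\<bar>h (ax i t) $ \<pi> i * (\<sigma> i / \<sigma> (\<pi> i)) - h (ax i u) $ \<pi> i * (\<sigma> i / \<sigma> (\<pi> i))\<bar> =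
        \<bar>h (ax i t) $ \<pi> i - h (ax i u) $ \<pi> i\<bar> / \<sigma> (\<pi> i) * \<sigma> i"
      using \<sigma>[of i] \<sigma>[of "\<pi> i"] unfolding left_diff_distrib[symmetric] by (simp add: abs_mult)
    ultimately show "\<bar>h (ax i t) $ \<pi> i * (\<sigma> i / \<sigma> (\<pi> i)) - h (ax i u) $ \<pi> i * (\<sigma> i / \<sigma> (\<pi> i))\<bar> = \<bar>t - u\<bar>"
      using \<sigma>[of i] by simp
  qed
  then obtain e where e: "\<And>i. \<bar>e i\<bar> = 1"
    "\<And>i t. \<bar>t\<bar> < r \<Longrightarrow> h (ax i t) $ \<pi> i * (\<sigma> i / \<sigma> (\<pi> i)) = h p $ \<pi> i * (\<sigma> i / \<sigma> (\<pi> i)) + e i * t"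
    unfolding ax0 by metis
  define c where "c i = e i * (\<sigma> (\<pi> i) / \<sigma> i)" for i
  have line: "h (ax i t) $ \<pi> i = h p $ \<pi> i + c i * t" if "\<bar>t\<bar> < r" for i t
    using e(2)[OF that, of i] \<sigma>[of i] \<sigma>[of "\<pi> i"] by (simp add: c_def field_simps)
  have c0: "c i \<noteq> 0" for i using e(1)[of i] \<sigma>[of i] \<sigma>[of "\<pi> i"] by (auto simp: c_def)
  \<comment> \<open>\<open>\<pi>\<close> leads from input to output coordinates, whereas a row of
    the matrix belongs to an output and asks for its input.\<close>
  define \<rho> where "\<rho> = inv \<pi>"
  have \<rho>: "\<rho> permutes UNIV" "\<pi> (\<rho> k) = k" for k
    using bij_imp_bij_inv[OF bij] surj_f_inv_f[OF \<open>surj \<pi>\<close>] by (auto simp: \<rho>_def intro!: bij_imp_permutes)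
  let ?A = "\<chi> k j. if j = \<rho> k then c (\<rho> k) else 0"
  have "generalized_permutation ?A"
    unfolding generalized_permutation_def using \<rho>(1) c0 by (intro exI[of _ \<rho>] exI[of _ "\<lambda>k. c (\<rho> k)"]) auto
  moreover have "h s = ?A *v s + (h p - ?A *v p)" if "s \<in> C" for s
  proof -
    have "h s $ k = h p $ k + c (\<rho> k) * (s $ \<rho> k - p $ \<rho> k)" for k
      using dep[OF that, of "\<rho> k"] line[of "s $ \<rho> k - p $ \<rho> k" "\<rho> k"] that by (auto simp: \<rho>(2) C_def)
    then show ?thesis
      by (simp add: vec_eq_iff matrix_vector_mult_generalized_permutation algebra_simps)
  qed
  ultimately show ?thesis by blast
qed

section \<open>From cubes to open connected sets\<close>

lemma affine_eq_on_open:
  fixes A A' :: "real^'n^'m"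
  assumes "open U" "p \<in> U" and eq: "\<And>s. s \<in> U \<Longrightarrow> A *v s + b = A' *v s + b'"
  shows "A = A'" "b = b'"
proof -
  obtain e where e: "0 < e" "ball p e \<subseteq> U" using assms(1,2) open_contains_ball by blast
  have p: "A *v p + b = A' *v p + b'" using eq assms(2) by blast
  have "A *v x = A' *v x" for x
  proof -
    define t where "t = e / (2 * (norm x + 1))"
    have n: "0 < norm x + 1" by (rule add_nonneg_pos) auto
    have t: "0 < t" using e(1) n by (simp add: t_def)
    have "t * norm x \<le> t * (norm x + 1)" using t by simp
    also have "\<dots> = e / 2" using n by (simp add: t_def field_simps)
    also have "\<dots> < e" using e(1) by simp
    finally have "p + t *\<^sub>R x \<in> U" using e t by (intro subsetD[OF e(2)]) (simp add: dist_norm)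
    from eq[OF this] have "(A *v p + b) + t *\<^sub>R (A *v x) = (A' *v p + b') + t *\<^sub>R (A' *v x)"
      by (simp add: matrix_vector_right_distrib matrix_vector_mult_scaleR algebra_simps)
    then have "t *\<^sub>R (A *v x) = t *\<^sub>R (A' *v x)" unfolding p by simp
    then show ?thesis using t by simp
  qed
  then show "A = A'" by (simp add: matrix_eq)
  with p show "b = b'" by simp
qed

text \<open>Cubes give the affine form only near each point. Affine maps that agree on a nonempty
  open set coincide, so the pair of matrix and offset is locally constant on \<open>S\<close>, and
  connectedness makes it constant.\<close>

lemma scaled_dist_isometry_open:
  fixes h :: "real^'n \<Rightarrow> real^'n"
  assumes \<beta>: "\<beta> \<in> {0<..<2} \<union> {2<..}" and \<sigma>: "\<And>i. 0 < \<sigma> i"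
    and S: "open S" "connected S"
    and h: "\<And>s t. s \<in> S \<Longrightarrow> t \<in> S \<Longrightarrow> scaled_dist \<sigma> \<beta> (h s) (h t) = scaled_dist \<sigma> \<beta> s t"
  shows "\<exists>A b. generalized_permutation A \<and> (\<forall>s\<in>S. h s = A *v s + b)"
proof -
  have loc: "\<exists>U A b. open U \<and> p \<in> U \<and> U \<subseteq> S \<and> generalized_permutation A \<and> (\<forall>s\<in>U. h s = A *v s + b)"
    if "p \<in> S" for p
  proof -
    obtain e where e: "0 < e" "ball p e \<subseteq> S" using openE[OF S(1) \<open>p \<in> S\<close>] by metis
    \<comment> \<open>The Euclidean norm is at most the sum of the absolute coordinates, so a cube
      of this half-width fits into the ball of radius \<open>e\<close>.\<close>
    define r where "r = e / CARD('n)"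
    have r: "0 < r" using e by (simp add: r_def)
    define C where "C = {s. \<forall>i. \<bar>s $ i - p $ i\<bar> < r}"
    have box: "C = box (p - (\<chi> i. r)) (p + (\<chi> i. r))"
      unfolding C_def by (auto simp: mem_box_cart abs_less_iff algebra_simps)
    have "s \<in> ball p e" if "s \<in> C" for s
    proof -
      have "norm (s - p) \<le> (\<Sum>i\<in>UNIV. \<bar>(s - p) $ i\<bar>)" by (rule norm_le_l1_cart)
      also have "\<dots> < (\<Sum>i\<in>(UNIV::'n set). r)" using that by (intro sum_strict_mono) (auto simp: C_def)
      finally show ?thesis using r by (simp add: r_def dist_norm norm_minus_commute)
    qed
    then have CS: "C \<subseteq> S" using e by auto
    have "\<exists>A b. generalized_permutation A \<and> (\<forall>s\<in>C. h s = A *v s + b)"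
      by (rule scaled_dist_isometry_cube[where \<sigma> = \<sigma>, OF \<beta> \<sigma> r C_def]) (use h CS in auto)
    moreover have "open C" unfolding box by (rule open_box)
    moreover have "p \<in> C" using r by (simp add: C_def)
    ultimately show ?thesis using CS by (intro exI[of _ C]) simp
  qed
  define F where "F p = (SOME x. generalized_permutation (fst x) \<and>
      (\<exists>U. open U \<and> p \<in> U \<and> U \<subseteq> S \<and> (\<forall>s\<in>U. h s = fst x *v s + snd x)))" for p
  have F: "generalized_permutation (fst (F p)) \<and>
      (\<exists>U. open U \<and> p \<in> U \<and> U \<subseteq> S \<and> (\<forall>s\<in>U. h s = fst (F p) *v s + snd (F p)))" if "p \<in> S" for p
  proof -
    obtain U A b where "open U" "p \<in> U" "U \<subseteq> S" "generalized_permutation A" "\<forall>s\<in>U. h s = A *v s + b"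
      using loc[OF \<open>p \<in> S\<close>] by (elim exE conjE) (rule that)
    then have "\<exists>x. generalized_permutation (fst x) \<and>
        (\<exists>U. open U \<and> p \<in> U \<and> U \<subseteq> S \<and> (\<forall>s\<in>U. h s = fst x *v s + snd x))"
      by (intro exI[where x = "(A, b)"] conjI exI[where x = U]) auto
    from someI_ex[OF this] show ?thesis unfolding F_def .
  qed
  have ev: "\<forall>\<^sub>F q in at p within S. F p = F q" if p: "p \<in> S" for p
  proof -
    obtain U where U: "open U" "p \<in> U" "U \<subseteq> S" "\<And>s. s \<in> U \<Longrightarrow> h s = fst (F p) *v s + snd (F p)"
      using F[OF p] by (elim exE conjE) (rule that, auto)
    have "F p = F q" if q: "q \<in> U" for q
    proof -
      obtain V where V: "open V" "q \<in> V" "V \<subseteq> S" "\<And>s. s \<in> V \<Longrightarrow> h s = fst (F q) *v s + snd (F q)"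
        using F[OF subsetD[OF U(3) q]] by (elim exE conjE) (rule that, auto)
      have o: "open (U \<inter> V)" "q \<in> U \<inter> V" using U V q by auto
      have e: "fst (F p) *v s + snd (F p) = fst (F q) *v s + snd (F q)" if "s \<in> U \<inter> V" for s
        using U(4)[of s] V(4)[of s] that by simp
      show ?thesis
        using affine_eq_on_open(1)[OF o e] affine_eq_on_open(2)[OF o e] by (rule prod_eqI)
    qed
    then show ?thesis using U(1,2) unfolding eventually_at_topological by blast
  qed
  show ?thesis
  proof (cases "S = {}")
    case True
    have "generalized_permutation (mat 1 :: real^'n^'n)"
      unfolding generalized_permutation_def mat_def
      by (intro exI[of _ id] exI[of _ "\<lambda>_. 1"]) (auto simp: permutes_id vec_eq_iff)
    with True show ?thesis by auto
  next
    case False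
    then obtain p where p: "p \<in> S" by auto
    have "F q = F p" if "q \<in> S" for q
      using connected_local_const[of S q p F] S(2) that p ev by auto
    then have "h s = fst (F p) *v s + snd (F p)" if "s \<in> S" for s
      using F[OF that] that by fastforce
    moreover have "generalized_permutation (fst (F p))" using F[OF p] ..
    ultimately show ?thesis by blast
  qed
qed

text \<open>A coordinate difference is bounded by a power of the distance, so preserving distances
  forces uniform continuity. The extension \<open>H\<close> to the closure preserves distances on
  \<open>S\<close>, and the open case applies to it.\<close>

lemma scaled_dist_isometry_dense:
  fixes h :: "real^'n \<Rightarrow> real^'n"
  assumes \<beta>: "\<beta> \<in> {0<..<2} \<union> {2<..}" and \<sigma>: "\<And>i. 0 < \<sigma> i"
    and S: "open S" "connected S" and G: "G \<subseteq> S" "S \<subseteq> closure G"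
    and h: "\<And>s t. s \<in> G \<Longrightarrow> t \<in> G \<Longrightarrow> scaled_dist \<sigma> \<beta> (h s) (h t) = scaled_dist \<sigma> \<beta> s t"
  shows "\<exists>A b. generalized_permutation A \<and> (\<forall>s\<in>G. h s = A *v s + b)"
proof -
  have \<beta>0: "0 < \<beta>" using \<beta> by auto
  have "uniformly_continuous_on G h"
    unfolding uniformly_continuous_on_def
  proof (intro allI impI)
    fix e :: real assume e: "0 < e"
    \<comment> \<open>A modulus of continuity for \<open>h\<close>: by translation invariance the
      distance of the images equals that of \<open>t - s\<close> from 0.\<close>
    define W where "W u = (\<Sum>i\<in>UNIV. \<sigma> i * scaled_dist \<sigma> \<beta> u 0 powr (1 / \<beta>))" for u
    have "continuous_on UNIV W"
      unfolding W_def using \<beta>0 \<sigma>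
      by (intro continuous_on_sum continuous_on_mult continuous_on_powr' continuous_on_scaled_dist continuous_intros) (auto simp: scaled_dist_nonneg)
    then have "isCont W 0" by (simp add: continuous_on_eq_continuous_at)
    then obtain d where d: "0 < d" "\<And>u. dist u 0 < d \<Longrightarrow> dist (W u) (W 0) < e"
      using e unfolding continuous_at_eps_delta by blast
    have "W 0 = 0" using \<beta>0 by (simp add: W_def)
    have "dist (h t) (h s) < e" if "s \<in> G" "t \<in> G" "dist t s < d" for s t
    proof -
      have "dist (h t) (h s) \<le> (\<Sum>i\<in>UNIV. \<bar>(h t - h s) $ i\<bar>)" unfolding dist_norm by (rule norm_le_l1_cart)
      also have "\<dots> \<le> (\<Sum>i\<in>UNIV. \<sigma> i * scaled_dist \<sigma> \<beta> (h t) (h s) powr (1 / \<beta>))"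
        using coord_le_scaled_dist[where \<sigma> = \<sigma>, OF \<beta>0 \<sigma>] by (intro sum_mono) auto
      also have "\<dots> = W (t - s)" using h[OF that(2,1)] by (simp add: W_def scaled_dist_def)
      also have "\<dots> < e" using d(2)[of "t - s"] that(3) \<open>W 0 = 0\<close> by (simp add: dist_norm)
      finally show ?thesis .
    qed
    with d(1) show "\<exists>d>0. \<forall>x\<in>G. \<forall>x'\<in>G. dist x' x < d \<longrightarrow> dist (h x') (h x) < e" by blast
  qed
  then obtain H where H: "uniformly_continuous_on (closure G) H" "\<And>x. x \<in> G \<Longrightarrow> h x = H x"
    by (rule uniformly_continuous_on_extension_on_closure) metis
  have cH: "continuous_on (closure G) H" using H(1) by (rule uniformly_continuous_imp_continuous)
  have "scaled_dist \<sigma> \<beta> (H s) (H t) = scaled_dist \<sigma> \<beta> s t" if "s \<in> S" "t \<in> S" for s t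
  proof -
    \<comment> \<open>One argument at a time is moved to the closure of \<open>G\<close>, here
      \<open>t\<close> and afterwards \<open>s\<close>.\<close>
    have 1: "scaled_dist \<sigma> \<beta> (H s) (H t) - scaled_dist \<sigma> \<beta> s t = 0" if "s \<in> G" "t \<in> closure G" for s t
      by (rule continuous_constant_on_closure[where S = G and f = "\<lambda>t. scaled_dist \<sigma> \<beta> (H s) (H t) - scaled_dist \<sigma> \<beta> s t"])
         (use that h H(2) cH \<beta>0 \<sigma> in \<open>auto intro!: continuous_on_diff continuous_on_scaled_dist continuous_intros\<close>)
    have "scaled_dist \<sigma> \<beta> (H s) (H t) - scaled_dist \<sigma> \<beta> s t = 0"
      by (rule continuous_constant_on_closure[where S = G and f = "\<lambda>s. scaled_dist \<sigma> \<beta> (H s) (H t) - scaled_dist \<sigma> \<beta> s t"])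
         (use that G(2) 1 cH \<beta>0 \<sigma> in \<open>auto intro!: continuous_on_diff continuous_on_scaled_dist continuous_intros\<close>)
    then show ?thesis by simp
  qed
  from scaled_dist_isometry_open[where \<sigma> = \<sigma>, OF \<beta> \<sigma> S this]
  show ?thesis using H(2) G(1) by (metis subsetD)
qed

section \<open>Minimizers of the losses\<close>

lemma ext_expectation_eq_integral:
  assumes "integrable M u"
  shows "ext_expectation M u = ereal (integral\<^sup>L M u)"
proof -
  have f: "(\<integral>\<^sup>+ x. ennreal (u x) \<partial>M) \<noteq> \<infinity>" "(\<integral>\<^sup>+ x. ennreal (- u x) \<partial>M) \<noteq> \<infinity>"
    using assms by (auto simp: real_integrable_def)
  have e: "enn2ereal x = ereal (enn2real x)" if "x \<noteq> \<infinity>" for x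
    using that by (cases x) auto
  show ?thesis
    unfolding ext_expectation_def real_lebesgue_integral_def[OF assms] e[OF f(1)] e[OF f(2)] by simp
qed

text \<open>With \<open>\<infinity> - \<infinity> = \<infinity>\<close>, a finite value leaves no
  room for an infinite positive or negative part.\<close>

lemma integrable_of_ext_expectation:
  assumes "u \<in> borel_measurable M" "\<bar>ext_expectation M u\<bar> \<noteq> \<infinity>"
  shows "integrable M u"
  using assms unfolding real_integrable_def ext_expectation_def
  by (cases "\<integral>\<^sup>+ x. ennreal (u x) \<partial>M"; cases "\<integral>\<^sup>+ x. ennreal (- u x) \<partial>M") auto

lemma ext_expectation_nonneg:
  assumes "\<And>x. 0 \<le> u x"
  shows "ext_expectation M u = enn2ereal (\<integral>\<^sup>+ x. ennreal (u x) \<partial>M)"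
proof -
  have "(\<integral>\<^sup>+ x. ennreal (- u x) \<partial>M) = (\<integral>\<^sup>+ x. 0 \<partial>M)"
    using assms by (intro nn_integral_cong) (auto simp: ennreal_neg)
  then show ?thesis by (simp add: ext_expectation_def zero_ennreal.rep_eq)
qed

lemma ext_expectation_uminus_nonneg:
  assumes "\<And>x. 0 \<le> u x"
  shows "ext_expectation M (\<lambda>x. - u x) = - enn2ereal (\<integral>\<^sup>+ x. ennreal (u x) \<partial>M)"
proof -
  have "(\<integral>\<^sup>+ x. ennreal (- u x) \<partial>M) = (\<integral>\<^sup>+ x. 0 \<partial>M)"
    using assms by (intro nn_integral_cong) (auto simp: ennreal_neg)
  then show ?thesis by (simp add: ext_expectation_def zero_ennreal.rep_eq)
qed

text \<open>\<open>F - G\<close> is non-negative with integral at most 0. The analysis of each loss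
  ends here, with \<open>G\<close> either the integrand at the ideal value or 0 after a difference
  has been formed.\<close>

lemma AE_eq_of_integral_le:
  fixes F G :: "'a \<Rightarrow> real"
  assumes "integrable M F" "integrable M G" "\<And>x. G x \<le> F x" "integral\<^sup>L M F \<le> integral\<^sup>L M G"
  shows "AE x in M. F x = G x"
proof -
  have "integral\<^sup>L M (\<lambda>x. F x - G x) = 0"
  proof (rule antisym)
    show "0 \<le> integral\<^sup>L M (\<lambda>x. F x - G x)" using assms(3) by (intro integral_nonneg_AE) auto
  qed (use assms in simp)
  then have "AE x in M. F x - G x = 0"
    using assms by (subst (asm) integral_nonneg_eq_0_iff_AE) auto
  then show ?thesis by eventually_elim simp
qed

lemma ln_ge_one_minus_inverse:
  fixes y :: real
  assumes "0 < y"
  shows "1 - 1 / y \<le> ln y" and "ln y = 1 - 1 / y \<Longrightarrow> y = 1"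
proof -
  show "1 - 1 / y \<le> ln y" using ln_le_minus_one[of "1/y"] assms by (simp add: ln_div)
  assume "ln y = 1 - 1 / y"
  then have "ln (1/y) = 1/y - 1" using assms by (simp add: ln_div)
  then have "1 / y = 1" using assms by (intro ln_eq_minus_one) auto
  then show "y = 1" using assms by simp
qed

section \<open>The losses with a single negative sample\<close>

lemma sigmoid_log: "- ln (sigmoid (- t)) = ln (1 + exp t)" "ln (1 - sigmoid (- t)) = - ln (1 + exp (- t))"
proof -
  have p: "0 < 1 + exp t" "0 < 1 + exp (- t)" by (auto intro: add_pos_pos)
  show "- ln (sigmoid (- t)) = ln (1 + exp t)" using p by (simp add: sigmoid_def ln_div)
  have "1 - sigmoid (- t) = 1 / (1 + exp (- t))" using p by (simp add: sigmoid_def exp_minus field_simps)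
  then show "ln (1 - sigmoid (- t)) = - ln (1 + exp (- t))" using p by (simp add: ln_div)
qed

text \<open>\<open>M\<close> plays the distribution of negative pairs and \<open>P\<close> that of
  positive pairs; \<open>E\<close> is minus the logarithm of the density of \<open>P\<close> with
  respect to \<open>M\<close>, the target for the dissimilarity.\<close>

locale density_ratio = prob_space M for M :: "'a measure" +
  fixes E :: "'a \<Rightarrow> real" and P :: "'a measure"
  assumes E[measurable]: "E \<in> borel_measurable M"
    and P: "P = density M (\<lambda>z. ennreal (exp (- E z)))"
    and prob_P: "prob_space P"
begin

lemma sets_P[measurable_cong]: "sets P = sets M" by (simp add: P)

lemma integrable_P: "f \<in> borel_measurable M \<Longrightarrow> integrable P f \<longleftrightarrow> integrable M (\<lambda>z. exp (- E z) * f z)"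
  unfolding P by (subst integrable_density) auto

lemma integral_P: "f \<in> borel_measurable M \<Longrightarrow> integral\<^sup>L P f = integral\<^sup>L M (\<lambda>z. exp (- E z) * f z)"
  unfolding P by (subst integral_density) auto

lemma nn_integral_ratio: "(\<integral>\<^sup>+ z. ennreal (exp (- E z)) \<partial>M) = 1"
proof -
  have "emeasure P (space P) = 1" using prob_P by (rule prob_space.emeasure_space_1)
  then show ?thesis by (simp add: P emeasure_density nn_set_integral_space)
qed

lemma integrable_ratio: "integrable M (\<lambda>z. exp (- E z))"
  using nn_integral_ratio by (intro integrableI_nonneg) auto

text \<open>Under \<open>M\<close> the integrand is
  \<open>exp (- E) * ln (1 + exp D) + ln (1 + exp (- D))\<close>. Both terms are non-negative, so a
  finite loss makes each of them integrable.\<close>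

lemma NCE_minimizer:
  fixes D :: "'a \<Rightarrow> real"
  defines "J \<equiv> \<lambda>D. ext_expectation P (\<lambda>z. - ln (sigmoid (- D z))) - ext_expectation M (\<lambda>z. ln (1 - sigmoid (- D z)))"
  assumes D[measurable]: "D \<in> borel_measurable M" and fin: "\<bar>J D\<bar> \<noteq> \<infinity>" and le: "J D \<le> J E"
  shows "AE z in M. D z = E z"
proof -
  have pos: "0 \<le> ln (1 + exp t)" "0 < 1 + exp t" for t :: real
    by (auto intro: ln_ge_zero add_pos_pos)
  have J: "J D = ext_expectation P (\<lambda>z. ln (1 + exp (D z))) + ext_expectation M (\<lambda>z. ln (1 + exp (- D z)))" for D
    unfolding J_def sigmoid_log
    by (simp add: ext_expectation_nonneg ext_expectation_uminus_nonneg pos minus_ereal_def)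
  let ?F = "\<lambda>D z. exp (- E z) * ln (1 + exp (D z)) + ln (1 + exp (- D z))"
  have Jint: "integrable M (?F D) \<and> J D = ereal (integral\<^sup>L M (?F D))"
    if [measurable]: "D \<in> borel_measurable M" and "integrable P (\<lambda>z. ln (1 + exp (D z)))" "integrable M (\<lambda>z. ln (1 + exp (- D z)))" for D
    using that by (simp add: J ext_expectation_eq_integral integrable_P integral_P)
  \<comment> \<open>Together with \<open>ln (1 + x) \<le> x\<close> for the other term, this bound
    makes the loss at \<open>E\<close> finite for every density ratio.\<close>
  have E1: "exp (- t) * ln (1 + exp t) \<le> 1" for t :: real
  proof -
    have "exp (- t) * ln (1 + exp t) \<le> exp (- t) * exp t"
      using pos(2)[of t] by (intro mult_left_mono) (auto intro: ln_add_one_self_le_self)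
    then show ?thesis by (simp flip: exp_add)
  qed
  have "integrable M (\<lambda>z. exp (- E z) * ln (1 + exp (E z)))"
    using E1 pos by (intro integrable_const_bound[where B = 1]) (auto simp: abs_mult)
  moreover have "integrable M (\<lambda>z. ln (1 + exp (- E z)))"
    using pos by (intro Bochner_Integration.integrable_bound[OF integrable_ratio])
      (auto intro!: ln_add_one_self_le_self)
  ultimately have JE: "integrable M (?F E)" "J E = ereal (integral\<^sup>L M (?F E))"
    using Jint[of E] by (auto simp: integrable_P)
  have "\<bar>ext_expectation P (\<lambda>z. ln (1 + exp (D z)))\<bar> \<noteq> \<infinity>" "\<bar>ext_expectation M (\<lambda>z. ln (1 + exp (- D z)))\<bar> \<noteq> \<infinity>"
    using fin unfolding J ext_expectation_nonneg[OF pos(1)]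
    by (cases "\<integral>\<^sup>+ z. ennreal (ln (1 + exp (D z))) \<partial>P"; cases "\<integral>\<^sup>+ z. ennreal (ln (1 + exp (- D z))) \<partial>M"; simp)+
  then have "integrable P (\<lambda>z. ln (1 + exp (D z)))" "integrable M (\<lambda>z. ln (1 + exp (- D z)))"
    by (auto intro!: integrable_of_ext_expectation)
  from Jint[OF D this] have JD: "integrable M (?F D)" "J D = ereal (integral\<^sup>L M (?F D))" by auto
  \<comment> \<open>Gibbs' inequality for the two-point distributions with odds \<open>exp (- t)\<close> and \<open>exp (- s)\<close>\<close>
  have gibbs: "exp (- t) * ln (1 + exp t) + ln (1 + exp (- t)) \<le> exp (- t) * ln (1 + exp s) + ln (1 + exp (- s))"
    "exp (- t) * ln (1 + exp s) + ln (1 + exp (- s)) = exp (- t) * ln (1 + exp t) + ln (1 + exp (- t)) \<Longrightarrow> s = t"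
    for s t :: real
  proof -
    define y1 y2 where "y1 = (1 + exp s) / (1 + exp t)" and "y2 = (1 + exp (- s)) / (1 + exp (- t))"
    have y: "0 < y1" "0 < y2" using pos(2) by (auto simp: y1_def y2_def)
    have ln1: "ln y1 = ln (1 + exp s) - ln (1 + exp t)" and ln2: "ln y2 = ln (1 + exp (- s)) - ln (1 + exp (- t))"
      using pos(2)[of s] pos(2)[of t] pos(2)[of "- s"] pos(2)[of "- t"] by (simp_all add: y1_def y2_def ln_div)
    have 1: "exp (- t) * (1 - 1 / y1) \<le> exp (- t) * ln y1" "1 - 1 / y2 \<le> ln y2"
      using ln_ge_one_minus_inverse(1) y by auto
    have "exp (- t) * (1 / y1) = (1 + exp (- t)) * (1 / (1 + exp s))"
    proof -
      have "exp (- t) * (1 / y1) = (exp (- t) * (1 + exp t)) * (1 / (1 + exp s))" by (simp add: y1_def)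
      also have "exp (- t) * (1 + exp t) = 1 + exp (- t)" by (simp add: distrib_left flip: exp_add)
      finally show ?thesis .
    qed
    moreover have "1 / y2 = (1 + exp (- t)) * (1 / (1 + exp (- s)))" by (simp add: y2_def)
    \<comment> \<open>The two predicted probabilities add up to 1, which makes the linear lower
      bounds of the logarithms cancel in the weighted sum.\<close>
    moreover have "1 / (1 + exp s) + 1 / (1 + exp (- s)) = 1"
      using pos(2)[of s] by (simp add: exp_minus field_simps)
    ultimately have "exp (- t) * (1 / y1) + 1 / y2 = 1 + exp (- t)"
      by (metis distrib_left mult.right_neutral)
    then have 2: "exp (- t) * (1 - 1 / y1) + (1 - 1 / y2) = 0" by (simp add: right_diff_distrib)
    show "exp (- t) * ln (1 + exp t) + ln (1 + exp (- t)) \<le> exp (- t) * ln (1 + exp s) + ln (1 + exp (- s))"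
      using 1 2 unfolding ln1 ln2 right_diff_distrib by linarith
    assume "exp (- t) * ln (1 + exp s) + ln (1 + exp (- s)) = exp (- t) * ln (1 + exp t) + ln (1 + exp (- t))"
    then have "ln y2 = 1 - 1 / y2"
      using 1 2 unfolding ln1 ln2 right_diff_distrib by linarith
    then have "y2 = 1" using ln_ge_one_minus_inverse(2) y by auto
    then have "1 + exp (- s) = 1 + exp (- t)" using pos(2)[of "- t"] by (simp add: y2_def)
    then show "s = t" by simp
  qed
  have "AE z in M. ?F D z = ?F E z"
    using le JD JE gibbs(1) by (intro AE_eq_of_integral_le) auto
  then show ?thesis by eventually_elim (rule gibbs(2))
qed

text \<open>The value at \<open>E\<close> is 1 minus the Kullback-Leibler divergence of
  \<open>P\<close> from \<open>M\<close>, which may be infinite. A value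
  \<open>- \<infinity>\<close> is excluded because \<open>D\<close> has a finite loss that is not
  larger.\<close>

lemma NWJ_minimizer:
  fixes D :: "'a \<Rightarrow> real"
  defines "J \<equiv> \<lambda>D. ext_expectation P D + ext_expectation M (\<lambda>z. exp (- D z))"
  assumes D[measurable]: "D \<in> borel_measurable M" and fin: "\<bar>J D\<bar> \<noteq> \<infinity>" and le: "J D \<le> J E"
  shows "AE z in M. D z = E z"
proof -
  let ?F = "\<lambda>D z. exp (- E z) * D z + exp (- D z)"
  have Jint: "integrable M (?F D) \<and> J D = ereal (integral\<^sup>L M (?F D))"
    if [measurable]: "D \<in> borel_measurable M" and "integrable P D" "integrable M (\<lambda>z. exp (- D z))" for D
    using that by (simp add: J_def ext_expectation_eq_integral integrable_P integral_P)
  have "(\<integral>\<^sup>+ z. ennreal (E z) \<partial>P) = (\<integral>\<^sup>+ z. ennreal (exp (- E z)) * ennreal (E z) \<partial>M)"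
    unfolding P by (rule nn_integral_density) auto
  also have "\<dots> \<le> (\<integral>\<^sup>+ z. 1 \<partial>M)"
  proof (rule nn_integral_mono)
    fix z
    \<comment> \<open>Since \<open>t \<le> exp t\<close>, the positive part of \<open>E\<close>
      always has a finite integral under \<open>P\<close>; only the negative part can make the loss
      infinite.\<close>
    have "exp (- E z) * E z \<le> exp (- E z) * exp (E z)"
      using exp_ge_add_one_self[of "E z"] by (intro mult_left_mono) (linarith, simp)
    then have "exp (- E z) * E z \<le> 1" by (simp flip: exp_add)
    then show "ennreal (exp (- E z)) * ennreal (E z) \<le> 1"
      by (simp add: ennreal_mult'[symmetric] ennreal_le_1)
  qed
  finally have p: "(\<integral>\<^sup>+ z. ennreal (E z) \<partial>P) < \<infinity>" by (simp add: emeasure_space_1 le_less_trans)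
  have "(\<integral>\<^sup>+ z. ennreal (- E z) \<partial>P) \<noteq> \<infinity>"
  proof
    assume "(\<integral>\<^sup>+ z. ennreal (- E z) \<partial>P) = \<infinity>"
    then have "ext_expectation P E = - \<infinity>" using p by (cases "\<integral>\<^sup>+ z. ennreal (E z) \<partial>P") (auto simp: ext_expectation_def)
    then have "J E = - \<infinity>" by (simp add: J_def ext_expectation_eq_integral[OF integrable_ratio])
    with le fin show False by auto
  qed
  with p have "integrable P E" by (simp add: real_integrable_def cong: measurable_cong_sets)
  then have JE: "integrable M (?F E)" "J E = ereal (integral\<^sup>L M (?F E))" using Jint[OF E] integrable_ratio by auto
  have "\<bar>ext_expectation P D\<bar> \<noteq> \<infinity>" "\<bar>ext_expectation M (\<lambda>z. exp (- D z))\<bar> \<noteq> \<infinity>"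
    using fin unfolding J_def ext_expectation_nonneg[OF exp_ge_zero]
    by (cases "ext_expectation P D"; cases "\<integral>\<^sup>+ z. ennreal (exp (- D z)) \<partial>M"; simp)+
  then have "integrable P D" "integrable M (\<lambda>z. exp (- D z))"
    by (auto intro!: integrable_of_ext_expectation)
  from Jint[OF D this] have JD: "integrable M (?F D)" "J D = ereal (integral\<^sup>L M (?F D))" by auto
  have young: "exp (- t) * t + exp (- t) \<le> exp (- t) * s + exp (- s)"
    "exp (- t) * s + exp (- s) = exp (- t) * t + exp (- t) \<Longrightarrow> s = t" for s t :: real
  proof -
    have e: "exp (- t) * s + exp (- s) - (exp (- t) * t + exp (- t)) = exp (- t) * (exp (t - s) - 1 - (t - s))"
      by (simp add: algebra_simps flip: exp_add)
    have "0 \<le> exp (- t) * (exp (t - s) - 1 - (t - s))"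
      using exp_ge_add_one_self[of "t - s"] by (intro mult_nonneg_nonneg) (simp, linarith)
    then show "exp (- t) * t + exp (- t) \<le> exp (- t) * s + exp (- s)" using e by linarith
    assume "exp (- t) * s + exp (- s) = exp (- t) * t + exp (- t)"
    then have "exp (t - s) - 1 = ln (exp (t - s))" using e by simp
    then have "exp (t - s) = 1" by (intro ln_eq_minus_one) auto
    then show "s = t" by simp
  qed
  have "AE z in M. ?F D z = ?F E z"
    using le JD JE young(1) by (intro AE_eq_of_integral_le) auto
  then show ?thesis by eventually_elim (rule young(2))
qed

text \<open>Formally the loss is the squared distance of \<open>exp (- D)\<close> and
  \<open>exp (- E)\<close> in the square-integrable functions of \<open>M\<close>, minus the squared
  norm of \<open>exp (- E)\<close>. That norm may be infinite, and then \<open>E\<close> itself has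
  loss \<open>\<infinity>\<close>. The \<open>En\<close> are bounded below, so their losses are
  finite, and they decrease to \<open>E\<close>.\<close>

lemma SCL_minimizer:
  fixes D :: "'a \<Rightarrow> real" and En :: "nat \<Rightarrow> 'a \<Rightarrow> real"
  defines "J \<equiv> \<lambda>D. ext_expectation P (\<lambda>z. - 2 * exp (- D z)) + ext_expectation M (\<lambda>z. exp (- 2 * D z))"
  assumes D[measurable]: "D \<in> borel_measurable M" and fin: "\<bar>J D\<bar> \<noteq> \<infinity>"
    and En[measurable]: "\<And>n. En n \<in> borel_measurable M" and le: "\<And>n. J D \<le> J (En n)"
    and bdd: "\<And>n z. C n \<le> En n z" and dec: "\<And>n z. En (Suc n) z \<le> En n z"
    and lim: "\<And>z. (\<lambda>n. En n z) \<longlonglongrightarrow> E z"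
  shows "AE z in M. D z = E z"
proof -
  let ?F = "\<lambda>D z. - 2 * (exp (- E z) * exp (- D z)) + (exp (- D z))\<^sup>2"
  have sq: "exp (- (2 * t)) = (exp (- t))\<^sup>2" for t :: real by (simp add: power2_eq_square flip: exp_add)
  have Jint: "integrable M (?F D) \<and> J D = ereal (integral\<^sup>L M (?F D))"
    if [measurable]: "D \<in> borel_measurable M" and "integrable P (\<lambda>z. 2 * exp (- D z))" "integrable M (\<lambda>z. exp (- 2 * D z))" for D
    using that by (simp add: J_def ext_expectation_eq_integral integrable_P integral_P sq)
  have "\<bar>ext_expectation P (\<lambda>z. - 2 * exp (- D z))\<bar> \<noteq> \<infinity>" "\<bar>ext_expectation M (\<lambda>z. exp (- 2 * D z))\<bar> \<noteq> \<infinity>"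
    using fin ext_expectation_uminus_nonneg[of "\<lambda>z. 2 * exp (- D z)" P] unfolding J_def ext_expectation_nonneg[OF exp_ge_zero]
    by (cases "\<integral>\<^sup>+ z. ennreal (2 * exp (- D z)) \<partial>P"; cases "\<integral>\<^sup>+ z. ennreal (exp (- 2 * D z)) \<partial>M"; simp)+
  then have "integrable P (\<lambda>z. - 2 * exp (- D z))" "integrable M (\<lambda>z. exp (- 2 * D z))"
    by - (rule integrable_of_ext_expectation, measurable)+
  from Jint[OF D _ this(2)] this(1) have JD: "integrable M (?F D)" "J D = ereal (integral\<^sup>L M (?F D))" by auto
  interpret P: prob_space P by (rule prob_P)
  have JE: "integrable M (?F (En n)) \<and> J (En n) = ereal (integral\<^sup>L M (?F (En n)))" for n
  proof (rule Jint)
    have "exp (- En n z) \<le> exp (- C n)" for z using bdd[of n z] by simp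
    then show "integrable P (\<lambda>z. 2 * exp (- En n z))"
      by (intro P.integrable_const_bound[where B = "2 * exp (- C n)"]) auto
    have "exp (- 2 * En n z) \<le> exp (- 2 * C n)" for z using bdd[of n z] by simp
    then show "integrable M (\<lambda>z. exp (- 2 * En n z))"
      by (intro integrable_const_bound[where B = "exp (- 2 * C n)"]) auto
  qed simp
  \<comment> \<open>Completing the squares adds the same \<open>(exp (- E z))^2\<close> to both
    integrands. It cancels here, so \<open>G n\<close> is integrable although the single squares
    need not be.\<close>
  define G where "G n z = ?F D z - ?F (En n) z" for n z
  have G: "G n z = (exp (- D z) - exp (- E z))\<^sup>2 - (exp (- En n z) - exp (- E z))\<^sup>2" for n z
    by (simp add: G_def power2_diff)
  have Gint: "integrable M (G n)" for n unfolding G_def using JD(1) JE by auto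
  have Gle: "integral\<^sup>L M (G n) \<le> 0" for n
    using le[of n] JD JE[of n] by (simp add: G_def[abs_def])
  have Glim: "(\<lambda>n. G n z) \<longlonglongrightarrow> (exp (- D z) - exp (- E z))\<^sup>2" for z
  proof -
    have "(\<lambda>n. G n z) \<longlonglongrightarrow> (exp (- D z) - exp (- E z))\<^sup>2 - (exp (- E z) - exp (- E z))\<^sup>2"
      unfolding G by (intro tendsto_intros lim)
    then show ?thesis by simp
  qed
  have Gmono: "mono (\<lambda>n. G n z)" for z
  proof (rule incseq_SucI)
    fix n
    have "decseq (\<lambda>n. En n z)" using dec by (rule decseq_SucI)
    then have "E z \<le> En (Suc n) z" using lim by (rule decseq_ge)
    then have "\<bar>exp (- En (Suc n) z) - exp (- E z)\<bar> \<le> \<bar>exp (- En n z) - exp (- E z)\<bar>"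
      using dec[of n z] by simp
    then show "G n z \<le> G (Suc n) z" unfolding G by (simp add: abs_le_square_iff)
  qed
  \<comment> \<open>The integrals increase and stay at most 0, so monotone convergence bounds the
    integral of the limiting square by 0.\<close>
  have "incseq (\<lambda>n. integral\<^sup>L M (G n))"
    using Gmono Gint by (auto intro!: incseq_SucI integral_mono simp: incseq_Suc_iff)
  then obtain x where x: "(\<lambda>n. integral\<^sup>L M (G n)) \<longlonglongrightarrow> x"
    using Gle incseq_convergent by metis
  have "x \<le> 0" using x Gle by (auto intro: LIMSEQ_le_const2)
  have 0: "integrable M (\<lambda>z. (exp (- D z) - exp (- E z))\<^sup>2)" "integral\<^sup>L M (\<lambda>z. (exp (- D z) - exp (- E z))\<^sup>2) = x"
    using integrable_monotone_convergence[OF Gint _ _ x, of "\<lambda>z. (exp (- D z) - exp (- E z))\<^sup>2"]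
      integral_monotone_convergence[OF Gint _ _ x, of "\<lambda>z. (exp (- D z) - exp (- E z))\<^sup>2"] Gmono Glim by auto
  have "AE z in M. (exp (- D z) - exp (- E z))\<^sup>2 = 0"
    using 0 \<open>x \<le> 0\<close> by (intro AE_eq_of_integral_le) auto
  then show ?thesis by eventually_elim simp
qed

end

section \<open>The InfoNCE loss\<close>

lemma (in prob_space) AE_ex:
  assumes "AE x in M. P x"
  shows "\<exists>x\<in>space M. P x"
proof (rule ccontr)
  assume "\<not> ?thesis"
  with assms AE_space[of M] have "AE x in M. False" by (auto elim: eventually_elim2)
  then show False by simp
qed

text \<open>Splitting coordinate \<open>i\<close> off the product leaves two independent copies of
  \<open>N\<close>, whose order of integration can be interchanged. This makes the slot of the
  positive sample exchangeable with that of a negative one.\<close>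

lemma nn_integral_PiM_swap_coordinate:
  assumes N: "prob_space N" and I: "finite I" "i \<in> I"
    and F[measurable]: "F \<in> borel_measurable (N \<Otimes>\<^sub>M (\<Pi>\<^sub>M j\<in>I. N))"
  shows "(\<integral>\<^sup>+ y. \<integral>\<^sup>+ xs. F (xs i, xs(i := y)) \<partial>(\<Pi>\<^sub>M j\<in>I. N) \<partial>N) = (\<integral>\<^sup>+ y. \<integral>\<^sup>+ xs. F (y, xs) \<partial>(\<Pi>\<^sub>M j\<in>I. N) \<partial>N)"
proof -
  interpret N: prob_space N by (rule N)
  interpret PN: product_prob_space "\<lambda>_. N" I ..
  define J where "J = I - {i}"
  have J: "finite J" "i \<notin> J" "I = insert i J" using I by (auto simp: J_def)
  interpret PJ: product_prob_space "\<lambda>_. N" J ..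
  interpret PJ': prob_space "\<Pi>\<^sub>M j\<in>J. N" by (rule PJ.prob_space_axioms)
  interpret NN: pair_prob_space N N ..
  have [measurable]: "F \<in> borel_measurable (N \<Otimes>\<^sub>M (\<Pi>\<^sub>M j\<in>insert i J. N))" using F J(3) by simp
  have split: "(\<integral>\<^sup>+ xs. H xs \<partial>(\<Pi>\<^sub>M j\<in>I. N)) = (\<integral>\<^sup>+ z. \<integral>\<^sup>+ xs. H (xs(i := z)) \<partial>(\<Pi>\<^sub>M j\<in>J. N) \<partial>N)"
    if "H \<in> borel_measurable (\<Pi>\<^sub>M j\<in>insert i J. N)" for H
    unfolding J(3) by (rule PN.product_nn_integral_insert_rev[OF J(1,2) that])
  have "(\<integral>\<^sup>+ y. \<integral>\<^sup>+ xs. F (xs i, xs(i := y)) \<partial>(\<Pi>\<^sub>M j\<in>I. N) \<partial>N)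
      = (\<integral>\<^sup>+ y. \<integral>\<^sup>+ z. \<integral>\<^sup>+ xs. F (z, xs(i := y)) \<partial>(\<Pi>\<^sub>M j\<in>J. N) \<partial>N \<partial>N)"
  proof (rule nn_integral_cong)
    fix y assume [measurable]: "y \<in> space N"
    have [measurable]: "(\<lambda>xs. xs(i := y)) \<in> measurable (\<Pi>\<^sub>M j\<in>insert i J. N) (\<Pi>\<^sub>M j\<in>insert i J. N)"
      by (rule measurable_fun_upd[where J = "insert i J"]) auto
    have "(\<lambda>xs. F (xs i, xs(i := y))) \<in> borel_measurable (\<Pi>\<^sub>M j\<in>insert i J. N)"
      by measurable
    from split[OF this] show "(\<integral>\<^sup>+ xs. F (xs i, xs(i := y)) \<partial>(\<Pi>\<^sub>M j\<in>I. N)) = (\<integral>\<^sup>+ z. \<integral>\<^sup>+ xs. F (z, xs(i := y)) \<partial>(\<Pi>\<^sub>M j\<in>J. N) \<partial>N)"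
      by simp
  qed
  also have "\<dots> = (\<integral>\<^sup>+ z. \<integral>\<^sup>+ y. \<integral>\<^sup>+ xs. F (z, xs(i := y)) \<partial>(\<Pi>\<^sub>M j\<in>J. N) \<partial>N \<partial>N)"
    by (rule NN.Fubini') measurable
  also have "\<dots> = (\<integral>\<^sup>+ z. \<integral>\<^sup>+ xs. F (z, xs) \<partial>(\<Pi>\<^sub>M j\<in>I. N) \<partial>N)"
    by (intro nn_integral_cong split[symmetric]) measurable
  finally show ?thesis .
qed

text \<open>\<open>q D\<close> is the softmax probability of the positive among \<open>K + 1\<close>
  candidates, and the loss is the mean of \<open>- ln (q D)\<close>. By exchangeability
  \<open>q D * u E\<close> has integral 1 for every \<open>D\<close>; this is the normalization
  behind Gibbs' inequality, which gives \<open>q D = q E\<close> almost everywhere. With the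
  negatives held fixed, this identity leaves \<open>D - E\<close> as a function of the
  anchor.\<close>

lemma INCE_minimizer:
  fixes D E :: "'a \<times> 'b \<Rightarrow> real" and K :: nat and P :: "'a measure" and N :: "'b measure"
    and R :: "('a \<times> 'b) measure"
  defines "J \<equiv> \<lambda>D. ext_expectation (R \<Otimes>\<^sub>M (\<Pi>\<^sub>M i\<in>{1..K}. N)) (\<lambda>(z, xs). - ln (exp (- D z) /
      (exp (- D z) + (\<Sum>i=1..K. exp (- D (fst z, xs i))))))"
  assumes P: "prob_space P" and N: "prob_space N" and K: "1 \<le> K"
    and R: "R = density (P \<Otimes>\<^sub>M N) (\<lambda>z. ennreal (exp (- E z)))" "prob_space R"
    and D[measurable]: "D \<in> borel_measurable (P \<Otimes>\<^sub>M N)" and E[measurable]: "E \<in> borel_measurable (P \<Otimes>\<^sub>M N)"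
    and fin: "\<bar>J D\<bar> \<noteq> \<infinity>" and le: "J D \<le> J E"
  shows "\<exists>a. AE z in P \<Otimes>\<^sub>M N. D z = E z + a (fst z)"
proof -
  define I where "I = {1..K}"
  have I: "finite I" "I \<noteq> {}" using K by (auto simp: I_def)
  interpret P: prob_space P by (rule P)
  interpret N: prob_space N by (rule N)
  interpret NI: prob_space "\<Pi>\<^sub>M j\<in>I. N" by (intro prob_space_PiM N)
  interpret PN: pair_prob_space P N ..
  interpret M: pair_prob_space "P \<Otimes>\<^sub>M N" "\<Pi>\<^sub>M j\<in>I. N" ..
  interpret dr: density_ratio "P \<Otimes>\<^sub>M N" E R
    by (intro density_ratio.intro density_ratio_axioms.intro PN.prob_space_axioms E R)
  let ?M = "(P \<Otimes>\<^sub>M N) \<Otimes>\<^sub>M (\<Pi>\<^sub>M j\<in>I. N)"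
  define u where "u D z xs = exp (- D z) + (\<Sum>i\<in>I. exp (- D (fst z, xs i)))" for D :: "'a \<times> 'b \<Rightarrow> real" and z xs
  define q where "q D z xs = exp (- D z) / u D z xs" for D z xs
  have u_pos: "0 < u D z xs" for D z xs unfolding u_def by (intro add_pos_nonneg sum_nonneg) auto
  have q_pos: "0 < q D z xs" for D z xs using u_pos by (simp add: q_def)
  have q_le: "q D z xs \<le> 1" for D z xs using u_pos[of D z xs] by (simp add: q_def u_def sum_nonneg)
  have [measurable]: "(\<lambda>w. exp (- D (fst (fst w), snd w i))) \<in> borel_measurable ?M"
    if [measurable]: "D \<in> borel_measurable (P \<Otimes>\<^sub>M N)" "i \<in> I" for D :: "'a \<times> 'b \<Rightarrow> real" and i
    by measurable
  have u_meas[measurable]: "(\<lambda>w. u D (fst w) (snd w)) \<in> borel_measurable ?M"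
    if [measurable]: "D \<in> borel_measurable (P \<Otimes>\<^sub>M N)" for D
    unfolding u_def by measurable
  have q_meas[measurable]: "(\<lambda>w. q D (fst w) (snd w)) \<in> borel_measurable ?M"
    if [measurable]: "D \<in> borel_measurable (P \<Otimes>\<^sub>M N)" for D
    unfolding q_def by measurable
  have iter: "(\<integral>\<^sup>+ w. F w \<partial>?M) = (\<integral>\<^sup>+ x. \<integral>\<^sup>+ y. \<integral>\<^sup>+ xs. F ((x, y), xs) \<partial>(\<Pi>\<^sub>M j\<in>I. N) \<partial>N \<partial>P)"
    if F[measurable]: "F \<in> borel_measurable ?M" for F
  proof -
    have "(\<integral>\<^sup>+ w. F w \<partial>?M) = (\<integral>\<^sup>+ z. \<integral>\<^sup>+ xs. F (z, xs) \<partial>(\<Pi>\<^sub>M j\<in>I. N) \<partial>(P \<Otimes>\<^sub>M N))"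
      by (rule NI.nn_integral_fst[OF F, symmetric])
    also have "\<dots> = (\<integral>\<^sup>+ x. \<integral>\<^sup>+ y. \<integral>\<^sup>+ xs. F ((x, y), xs) \<partial>(\<Pi>\<^sub>M j\<in>I. N) \<partial>N \<partial>P)"
      by (rule N.nn_integral_fst[symmetric]) measurable
    finally show ?thesis .
  qed
  have swap: "(\<integral>\<^sup>+ w. F ((fst (fst w), snd w i), (snd w)(i := snd (fst w))) \<partial>?M) = (\<integral>\<^sup>+ w. F w \<partial>?M)"
    if i: "i \<in> I" and F[measurable]: "F \<in> borel_measurable ?M" for F i
  proof -
    have upd[measurable]: "(\<lambda>w. (snd w)(i := snd (fst w))) \<in> measurable ?M (\<Pi>\<^sub>M j\<in>I. N)"
      by (rule measurable_fun_upd[where J = I]) (use i in auto)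
    have sndi: "(\<lambda>w. snd w i) \<in> measurable ?M N"
      by (rule measurable_compose[OF measurable_snd measurable_component_singleton[OF i]])
    have T: "(\<lambda>w. ((fst (fst w), snd w i), (snd w)(i := snd (fst w)))) \<in> measurable ?M ?M"
      by (intro measurable_Pair upd sndi) measurable
    have "(\<integral>\<^sup>+ w. F ((fst (fst w), snd w i), (snd w)(i := snd (fst w))) \<partial>?M) =
        (\<integral>\<^sup>+ x. \<integral>\<^sup>+ y. \<integral>\<^sup>+ xs. F ((x, xs i), xs(i := y)) \<partial>(\<Pi>\<^sub>M j\<in>I. N) \<partial>N \<partial>P)"
      by (subst iter[OF measurable_compose[OF T F]]) simp
    also have "\<dots> = (\<integral>\<^sup>+ x. \<integral>\<^sup>+ y. \<integral>\<^sup>+ xs. F ((x, y), xs) \<partial>(\<Pi>\<^sub>M j\<in>I. N) \<partial>N \<partial>P)"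
    proof (rule nn_integral_cong)
      fix x assume [measurable]: "x \<in> space P"
      show "(\<integral>\<^sup>+ y. \<integral>\<^sup>+ xs. F ((x, xs i), xs(i := y)) \<partial>(\<Pi>\<^sub>M j\<in>I. N) \<partial>N) = (\<integral>\<^sup>+ y. \<integral>\<^sup>+ xs. F ((x, y), xs) \<partial>(\<Pi>\<^sub>M j\<in>I. N) \<partial>N)"
        using nn_integral_PiM_swap_coordinate[OF N I(1) i, of "\<lambda>(y, xs). F ((x, y), xs)"] by simp
    qed
    also have "\<dots> = (\<integral>\<^sup>+ w. F w \<partial>?M)"
      by (rule iter[OF F, symmetric])
    finally show ?thesis .
  qed
  have r1: "(\<integral>\<^sup>+ w. ennreal (exp (- E (fst w))) \<partial>?M) = 1"
    by (subst NI.nn_integral_fst[symmetric]) (measurable, simp add: dr.nn_integral_ratio NI.emeasure_space_1)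
  \<comment> \<open>exchangeability of the positive sample with each negative one\<close>
  have q1: "(\<integral>\<^sup>+ w. ennreal (q D (fst w) (snd w) * u E (fst w) (snd w)) \<partial>?M) = 1"
    if [measurable]: "D \<in> borel_measurable (P \<Otimes>\<^sub>M N)" for D
  proof -
    have sw: "(\<integral>\<^sup>+ w. ennreal (q D (fst w) (snd w) * exp (- E (fst (fst w), snd w i))) \<partial>?M) =
      (\<integral>\<^sup>+ w. ennreal (exp (- D (fst (fst w), snd w i)) / u D (fst w) (snd w) * exp (- E (fst w))) \<partial>?M)" if i: "i \<in> I" for i
    proof -
      \<comment> \<open>\<open>u D\<close> sums over all candidates, so it is symmetric under
        exchanging the positive with the \<open>i\<close>-th negative.\<close>
      have us: "u D (fst z, xs i) (xs(i := snd z)) = u D z xs" for z xs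
      proof -
        have "(\<Sum>j\<in>I. exp (- D (fst z, (xs(i := snd z)) j))) = exp (- D z) + (\<Sum>j\<in>I - {i}. exp (- D (fst z, xs j)))"
          by (subst sum.remove[OF I(1) i]) (auto intro!: sum.cong)
        moreover have "(\<Sum>j\<in>I. exp (- D (fst z, xs j))) = exp (- D (fst z, xs i)) + (\<Sum>j\<in>I - {i}. exp (- D (fst z, xs j)))"
          by (rule sum.remove[OF I(1) i])
        ultimately show ?thesis by (simp add: u_def)
      qed
      have [measurable]: "i \<in> I" by (rule i)
      show ?thesis
        by (subst swap[OF i, of "\<lambda>w. ennreal (exp (- D (fst (fst w), snd w i)) / u D (fst w) (snd w) * exp (- E (fst w)))", symmetric])
           (simp_all add: us q_def)
    qed
    have "(\<integral>\<^sup>+ w. ennreal (q D (fst w) (snd w) * u E (fst w) (snd w)) \<partial>?M) =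
       (\<integral>\<^sup>+ w. ennreal (q D (fst w) (snd w) * exp (- E (fst w))) + (\<Sum>i\<in>I. ennreal (q D (fst w) (snd w) * exp (- E (fst (fst w), snd w i)))) \<partial>?M)"
      using q_pos by (intro nn_integral_cong)
        (simp add: u_def distrib_left sum_distrib_left sum_nonneg less_imp_le sum_ennreal flip: ennreal_plus)
    also have "\<dots> = (\<integral>\<^sup>+ w. ennreal (q D (fst w) (snd w) * exp (- E (fst w))) \<partial>?M)
        + (\<Sum>i\<in>I. \<integral>\<^sup>+ w. ennreal (q D (fst w) (snd w) * exp (- E (fst (fst w), snd w i))) \<partial>?M)"
      by (subst nn_integral_add) (auto simp: nn_integral_sum)
    also have "\<dots> = (\<integral>\<^sup>+ w. ennreal (q D (fst w) (snd w) * exp (- E (fst w))) \<partial>?M)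
        + (\<Sum>i\<in>I. \<integral>\<^sup>+ w. ennreal (exp (- D (fst (fst w), snd w i)) / u D (fst w) (snd w) * exp (- E (fst w))) \<partial>?M)"
      by (simp add: sw)
    also have "\<dots> = (\<integral>\<^sup>+ w. ennreal (q D (fst w) (snd w) * exp (- E (fst w))) + (\<Sum>i\<in>I. ennreal (exp (- D (fst (fst w), snd w i)) / u D (fst w) (snd w) * exp (- E (fst w)))) \<partial>?M)"
      by (subst nn_integral_add) (auto simp: nn_integral_sum)
    also have "\<dots> = (\<integral>\<^sup>+ w. ennreal (exp (- E (fst w))) \<partial>?M)"
    proof (rule nn_integral_cong)
      fix w
      let ?u = "u D (fst w) (snd w)"
      have "q D (fst w) (snd w) * exp (- E (fst w)) + (\<Sum>i\<in>I. exp (- D (fst (fst w), snd w i)) / ?u * exp (- E (fst w)))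
          = (?u / ?u) * exp (- E (fst w))"
      proof -
        have "a / U * c + (\<Sum>i\<in>I. b i / U * c) = (a + (\<Sum>i\<in>I. b i)) / U * c" for a b c and U :: real
          by (simp add: add_divide_distrib distrib_right sum_distrib_right sum_divide_distrib)
        then show ?thesis unfolding q_def by (simp only: u_def)
      qed
      also have "?u / ?u = 1" using u_pos[of D "fst w" "snd w"] by simp
      finally show "ennreal (q D (fst w) (snd w) * exp (- E (fst w))) + (\<Sum>i\<in>I. ennreal (exp (- D (fst (fst w), snd w i)) / ?u * exp (- E (fst w)))) = ennreal (exp (- E (fst w)))"
        using q_pos[of D "fst w" "snd w"] u_pos[of D "fst w" "snd w"]
        by (simp add: sum_nonneg less_imp_le sum_ennreal flip: ennreal_plus)
    qed
    finally show ?thesis unfolding r1 .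
  qed
  have qint: "integrable ?M (\<lambda>w. q D (fst w) (snd w) * u E (fst w) (snd w))"
    "integral\<^sup>L ?M (\<lambda>w. q D (fst w) (snd w) * u E (fst w) (snd w)) = 1"
    if [measurable]: "D \<in> borel_measurable (P \<Otimes>\<^sub>M N)" for D
  proof -
    have nn: "0 \<le> q D z xs * u E z xs" for z xs using q_pos[of D z xs] u_pos[of E z xs] by simp
    show "integrable ?M (\<lambda>w. q D (fst w) (snd w) * u E (fst w) (snd w))"
      using q1[OF that] nn by (intro integrableI_nonneg) auto
    show "integral\<^sup>L ?M (\<lambda>w. q D (fst w) (snd w) * u E (fst w) (snd w)) = 1"
      using q1[OF that] nn by (subst integral_eq_nn_integral) auto
  qed
  have qE: "q E z xs * u E z xs = exp (- E z)" for z xs using u_pos[of E z xs] by (simp add: q_def)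
  have RM: "R \<Otimes>\<^sub>M (\<Pi>\<^sub>M i\<in>I. N) = density ?M (\<lambda>w. ennreal (exp (- E (fst w))))"
  proof -
    have "R \<Otimes>\<^sub>M density (\<Pi>\<^sub>M i\<in>I. N) (\<lambda>_. 1) = density ?M (\<lambda>(z, xs). ennreal (exp (- E z)) * 1)"
      unfolding R(1) by (rule pair_measure_density) (auto simp: density_1 NI.sigma_finite_measure_axioms)
    then show ?thesis by (simp add: density_1 split_beta')
  qed
  have J: "J D = ext_expectation (R \<Otimes>\<^sub>M (\<Pi>\<^sub>M i\<in>I. N)) (\<lambda>w. - ln (q D (fst w) (snd w)))" for D
    by (simp add: J_def q_def u_def I_def split_beta')
  let ?F = "\<lambda>D w. exp (- E (fst w)) * - ln (q D (fst w) (snd w))"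
  have Fnn: "0 \<le> - ln (q D z xs)" for D z xs using q_pos[of D z xs] q_le[of D z xs] by simp
  have JF: "J D = enn2ereal (\<integral>\<^sup>+ w. ennreal (?F D w) \<partial>?M)" if [measurable]: "D \<in> borel_measurable (P \<Otimes>\<^sub>M N)" for D
    unfolding J ext_expectation_nonneg[OF Fnn] RM
    by (subst nn_integral_density) (auto simp: ennreal_mult'[symmetric])
  have Fi: "integrable ?M (?F D) \<and> J D = ereal (integral\<^sup>L ?M (?F D))" if [measurable]: "D \<in> borel_measurable (P \<Otimes>\<^sub>M N)" and "\<bar>J D\<bar> \<noteq> \<infinity>" for D
  proof -
    have nn: "0 \<le> ?F D w" for w using Fnn by (intro mult_nonneg_nonneg) auto
    have lt: "(\<integral>\<^sup>+ w. ennreal (?F D w) \<partial>?M) < \<infinity>"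
      using that(2) unfolding JF[OF that(1)] by (cases "\<integral>\<^sup>+ w. ennreal (?F D w) \<partial>?M") auto
    then have i: "integrable ?M (?F D)" using nn by (intro integrableI_nonneg) auto
    moreover have "(\<integral>\<^sup>+ w. ennreal (?F D w) \<partial>?M) = ennreal (integral\<^sup>L ?M (?F D))"
      by (rule nn_integral_eq_integral[OF i]) (rule AE_I2, rule nn)
    moreover have "0 \<le> integral\<^sup>L ?M (?F D)" by (rule integral_nonneg_AE) (rule AE_I2, rule nn)
    ultimately show ?thesis by (simp only: JF[OF that(1)] enn2ereal_ennreal simp_thms)
  qed
  have "\<bar>J E\<bar> \<noteq> \<infinity>"
  proof -
    \<comment> \<open>This follows from \<open>- ln q \<le> 1 / q - 1\<close>; the majorant
      \<open>u E\<close> has the finite integral \<open>K + 1\<close>.\<close>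
    have "?F E w \<le> u E (fst w) (snd w)" for w
    proof -
      have "exp (- E (fst w)) * - ln (q E (fst w) (snd w)) \<le> exp (- E (fst w)) * (1 / q E (fst w) (snd w) - 1)"
        using ln_ge_one_minus_inverse(1)[OF q_pos] by (intro mult_left_mono) (auto simp: algebra_simps)
      also have "\<dots> = u E (fst w) (snd w) - exp (- E (fst w))"
        by (simp add: q_def right_diff_distrib)
      finally show ?thesis by (simp add: algebra_simps) (smt (verit) exp_ge_zero)
    qed
    then have "(\<integral>\<^sup>+ w. ennreal (?F E w) \<partial>?M) \<le> (\<integral>\<^sup>+ w. ennreal (u E (fst w) (snd w)) \<partial>?M)"
      by (intro nn_integral_mono ennreal_leI)
    also have "\<dots> = (\<integral>\<^sup>+ w. ennreal (exp (- E (fst w))) + (\<Sum>i\<in>I. ennreal (exp (- E (fst (fst w), snd w i)))) \<partial>?M)"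
      by (intro nn_integral_cong) (simp add: u_def sum_nonneg sum_ennreal flip: ennreal_plus)
    also have "\<dots> = 1 + (\<Sum>i\<in>I. \<integral>\<^sup>+ w. ennreal (exp (- E (fst (fst w), snd w i))) \<partial>?M)"
      by (subst nn_integral_add) (auto simp: nn_integral_sum r1 simp del: sum_ennreal)
    also have "\<dots> = 1 + (\<Sum>i\<in>I. 1)"
      using swap[of _ "\<lambda>w. ennreal (exp (- E (fst w)))"] r1 by (intro arg_cong2[where f = "(+)"] sum.cong) auto
    also have "\<dots> < \<infinity>" by (simp add: ennreal_add_eq_top less_top[symmetric])
    finally show ?thesis unfolding JF[OF E] by (cases "\<integral>\<^sup>+ w. ennreal (?F E w) \<partial>?M") auto
  qed
  note JE = Fi[OF E this] and JD = Fi[OF D fin]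
  \<comment> \<open>The subtracted bracket has integral \<open>1 - 1 = 0\<close> and turns the
    difference of the integrands into a pointwise non-negative function.\<close>
  let ?G = "\<lambda>w. ?F D w - ?F E w - (exp (- E (fst w)) - q D (fst w) (snd w) * u E (fst w) (snd w))"
  have G: "?G w = exp (- E (fst w)) * (ln (q E (fst w) (snd w) / q D (fst w) (snd w))
      - (1 - 1 / (q E (fst w) (snd w) / q D (fst w) (snd w))))" for w
  proof -
    have "q D (fst w) (snd w) * u E (fst w) (snd w) = exp (- E (fst w)) * (q D (fst w) (snd w) / q E (fst w) (snd w))"
      unfolding qE[of "fst w" "snd w", symmetric] using q_pos[of E "fst w" "snd w"] by simp
    then show ?thesis using q_pos[of E "fst w" "snd w"] q_pos[of D "fst w" "snd w"]
      by (simp add: ln_div algebra_simps)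
  qed
  have iE: "integrable ?M (\<lambda>w. exp (- E (fst w)))" "integral\<^sup>L ?M (\<lambda>w. exp (- E (fst w))) = 1"
    using qint[OF E] by (simp_all add: qE)
  have q': "0 < q E (fst w) (snd w) / q D (fst w) (snd w)" for w using q_pos by simp
  have "AE w in ?M. ?G w = 0"
  proof (rule AE_eq_of_integral_le)
    show "integrable ?M ?G" using JD JE iE(1) qint(1)[OF D] by (intro Bochner_Integration.integrable_diff) auto
    have "integral\<^sup>L ?M ?G = integral\<^sup>L ?M (?F D) - integral\<^sup>L ?M (?F E) - (1 - 1)"
      using JD JE iE qint[OF D] by (subst Bochner_Integration.integral_diff | simp)+
    then show "integral\<^sup>L ?M ?G \<le> integral\<^sup>L ?M (\<lambda>_. 0)" using JD JE le by simp
    show "0 \<le> ?G w" for w unfolding G using ln_ge_one_minus_inverse(1)[OF q'] by simp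
  qed simp
  then have "AE w in ?M. q E (fst w) (snd w) = q D (fst w) (snd w)"
  proof eventually_elim
    case (elim w)
    then have "q E (fst w) (snd w) / q D (fst w) (snd w) = 1"
      unfolding G using ln_ge_one_minus_inverse(2)[OF q'] by simp
    then show ?case using q_pos[of D "fst w" "snd w"] by simp
  qed
  then have "AE z in P \<Otimes>\<^sub>M N. AE xs in (\<Pi>\<^sub>M j\<in>I. N). q E z xs = q D z xs"
    by (intro M.AE_pair[where Q = "\<lambda>w. q E (fst w) (snd w) = q D (fst w) (snd w)", simplified])
  then have "AE xs in (\<Pi>\<^sub>M j\<in>I. N). AE z in P \<Otimes>\<^sub>M N. q E z xs = q D z xs"
    by (subst M.AE_commute[symmetric]) measurable
  \<comment> \<open>One sample of negatives is frozen. Its contribution \<open>s D\<close> to the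
    denominator depends on the anchor only, and \<open>1 \<le> K\<close> makes it positive.\<close>
  then obtain xs where xs: "AE z in P \<Otimes>\<^sub>M N. q E z xs = q D z xs"
    using NI.AE_ex by blast
  define s where "s D x = (\<Sum>i\<in>I. exp (- D (x, xs i)))" for D :: "'a \<times> 'b \<Rightarrow> real" and x
  have s_pos: "0 < s D x" for D x unfolding s_def using I by (intro sum_pos) auto
  have "AE z in P \<Otimes>\<^sub>M N. D z = E z + (ln (s E (fst z)) - ln (s D (fst z)))"
    using xs
  proof eventually_elim
    case (elim z)
    have "exp (- E z) * (exp (- D z) + s D (fst z)) = exp (- D z) * (exp (- E z) + s E (fst z))"
      using elim u_pos[of E z xs] u_pos[of D z xs] by (simp add: q_def u_def s_def[symmetric] field_simps)
    then have "exp (- E z) * s D (fst z) = exp (- D z) * s E (fst z)" by (simp add: algebra_simps)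
    then have "ln (exp (- E z) * s D (fst z)) = ln (exp (- D z) * s E (fst z))" by simp
    then show ?case using s_pos[of D "fst z"] s_pos[of E "fst z"] by (simp add: ln_mult)
  qed
  then show ?thesis by (intro exI[of _ "\<lambda>x. ln (s E x) - ln (s D x)"]) simp
qed

section \<open>Identifiability from an almost everywhere equation\<close>

text \<open>Discarding the preimages of those basis sets whose preimage is null removes only
  countably many null sets. The points that remain are mapped into the support of the image
  measure.\<close>

lemma AE_regular_point:
  fixes k :: "'a \<Rightarrow> 'b::second_countable_topology"
  assumes k[measurable]: "k \<in> borel_measurable M"
  shows "AE s in M. \<forall>U. open U \<longrightarrow> k s \<in> U \<longrightarrow> 0 < emeasure M (k -` U \<inter> space M)"
proof -
  obtain B :: "'b set set" where B: "countable B" "topological_basis B" using ex_countable_basis by blast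
  have openB: "open b" if "b \<in> B" for b using B(2) that by (rule topological_basis_open)
  define B0 where "B0 = {b \<in> B. emeasure M (k -` b \<inter> space M) = 0}"
  have "countable B0" using B(1) by (auto simp: B0_def intro: countable_subset)
  moreover have "AE s in M. k s \<notin> b" if "b \<in> B0" for b
  proof (rule AE_I)
    show "{s \<in> space M. \<not> k s \<notin> b} \<subseteq> k -` b \<inter> space M" by auto
    show "k -` b \<inter> space M \<in> sets M" using that openB by (auto simp: B0_def intro!: measurable_sets[OF k])
  qed (use that in \<open>auto simp: B0_def\<close>)
  ultimately have "AE s in M. \<forall>b\<in>B0. k s \<notin> b" by (subst AE_ball_countable) auto
  then show ?thesis
  proof eventually_elim
    case (elim s)
    show ?case
    proof (intro allI impI)
      fix U assume U: "open U" "k s \<in> U"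
      obtain b where b: "b \<in> B" "k s \<in> b" "b \<subseteq> U" using topological_basisE[OF B(2) U] .
      then have "0 < emeasure M (k -` b \<inter> space M)" using elim by (auto simp: B0_def zero_less_iff_neq_zero)
      also have "\<dots> \<le> emeasure M (k -` U \<inter> space M)"
        using b(3) U(1) by (intro emeasure_mono measurable_sets[OF k]) auto
      finally show "0 < emeasure M (k -` U \<inter> space M)" .
    qed
  qed
qed

text \<open>The substitute for a limit when \<open>k\<close> is not continuous: if
  \<open>\<Phi> (k s)\<close> differed from \<open>c\<close>, then so would \<Phi> on a
  neighbourhood of \<open>k s\<close>, whose preimage has positive measure.\<close>

lemma regular_point_eq:
  fixes k :: "'a \<Rightarrow> 'b::topological_space" and \<Phi> :: "'b \<Rightarrow> 'c::t1_space"
  assumes reg: "\<And>U. open U \<Longrightarrow> k s \<in> U \<Longrightarrow> 0 < emeasure M (k -` U \<inter> space M)"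
    and \<Phi>: "continuous_on UNIV \<Phi>" and ae: "AE t in M. \<Phi> (k t) = c"
  shows "\<Phi> (k s) = c"
proof (rule ccontr)
  assume ne: "\<Phi> (k s) \<noteq> c"
  define U where "U = \<Phi> -` (- {c})"
  have "open U" unfolding U_def by (rule open_vimage[OF _ \<Phi>]) auto
  then have pos: "0 < emeasure M (k -` U \<inter> space M)" using ne by (intro reg) (auto simp: U_def)
  then have "k -` U \<inter> space M \<in> sets M" using emeasure_notin_sets by fastforce
  then have "k -` U \<inter> space M \<in> null_sets M"
    using ae by (subst AE_iff_null_sets) (auto simp: U_def elim: eventually_mono)
  with pos show False by auto
qed

lemma emeasure_lborel_open_pos:
  fixes U :: "'a::euclidean_space set"
  assumes "open U" "U \<noteq> {}"
  shows "0 < emeasure lborel U"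
proof -
  have "emeasure lebesgue U \<noteq> 0"
    using open_not_negligible[OF assms] assms(1) by (simp add: negligible_iff_emeasure0)
  then show ?thesis using assms(1) by (simp add: emeasure_completion zero_less_iff_neq_zero)
qed

lemma continuous_regular_point:
  fixes k :: "'a::euclidean_space \<Rightarrow> 'b::topological_space"
  assumes S: "open S" and k: "continuous_on S k" and "s \<in> S" "open U" "k s \<in> U"
  shows "0 < emeasure (restrict_space lborel S) (k -` U \<inter> space (restrict_space lborel S))"
proof -
  have "open (k -` U \<inter> S)" using continuous_open_preimage[OF k S \<open>open U\<close>] by (simp add: Int_commute)
  then show ?thesis
    using assms by (subst emeasure_restrict_space)
      (auto simp: space_restrict_space intro!: emeasure_lborel_open_pos)
qed

text \<open>The difference of the two equations is free of \<open>b\<close>, and \<Phi> equals the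
  constant \<open>a - a'\<close> along the graph of \<open>h\<close>. At \<open>s\<close> and at
  \<open>s'\<close> it takes opposite values by the symmetry of the distance, so both
  vanish.\<close>

lemma scaled_dist_eq_of_AE:
  fixes h :: "real^'n \<Rightarrow> real^'n"
  assumes \<beta>: "0 < \<beta>" and \<sigma>: "\<And>i. 0 < \<sigma> i"
    and reg: "\<And>U. open U \<Longrightarrow> (s, h s) \<in> U \<Longrightarrow> 0 < emeasure M ((\<lambda>t. (t, h t)) -` U \<inter> space M)"
    and reg': "\<And>U. open U \<Longrightarrow> (s', h s') \<in> U \<Longrightarrow> 0 < emeasure M ((\<lambda>t. (t, h t)) -` U \<inter> space M)"
    and ae: "AE t in M. scaled_dist \<sigma> \<beta> (h s) (h t) = scaled_dist \<sigma> \<beta> s t + a + b t"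
    and ae': "AE t in M. scaled_dist \<sigma> \<beta> (h s') (h t) = scaled_dist \<sigma> \<beta> s' t + a' + b t"
  shows "scaled_dist \<sigma> \<beta> (h s) (h s') = scaled_dist \<sigma> \<beta> s s'"
proof -
  define \<Phi> where "\<Phi> p = scaled_dist \<sigma> \<beta> (h s) (snd p) - scaled_dist \<sigma> \<beta> (h s') (snd p)
      - (scaled_dist \<sigma> \<beta> s (fst p) - scaled_dist \<sigma> \<beta> s' (fst p))" for p
  have c: "continuous_on UNIV \<Phi>"
    unfolding \<Phi>_def using \<beta> \<sigma> by (intro continuous_on_diff continuous_on_scaled_dist continuous_intros)
  have "AE t in M. \<Phi> (t, h t) = a - a'"
    using ae ae' by eventually_elim (simp add: \<Phi>_def)
  from regular_point_eq[where k = "\<lambda>t. (t, h t)", OF reg c this] regular_point_eq[where k = "\<lambda>t. (t, h t)", OF reg' c this]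
  have "\<Phi> (s, h s) = \<Phi> (s', h s')" by simp
  then show ?thesis by (simp add: \<Phi>_def scaled_dist_commute[of _ _ "h s'" "h s"] scaled_dist_commute[of _ _ s' s])
qed

text \<open>The inverse need not be continuous on the image. However, an open set is a countable
  union of compact boxes, and \<open>g\<close> maps each of them to a compact set, hence to a Borel
  set.\<close>

lemma borel_measurable_inv_into_continuous:
  fixes g :: "'a::euclidean_space \<Rightarrow> 'b::{second_countable_topology, t2_space}"
  assumes S: "open S" and g: "continuous_on S g" "inj_on g S"
  shows "inv_into S g \<in> borel_measurable (restrict_space borel (g ` S))"
proof (rule borel_measurableI)
  fix U :: "'a set" assume "open U"
  then have "open (S \<inter> U)" using S by auto
  then obtain \<D> where \<D>: "countable \<D>" "\<D> \<subseteq> Pow (S \<inter> U)" "\<And>C. C \<in> \<D> \<Longrightarrow> \<exists>a b. C = cbox a b" "\<Union>\<D> = S \<inter> U"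
    using open_countable_Union_open_cbox by metis
  have "compact (g ` C)" if "C \<in> \<D>" for C
  proof (rule compact_continuous_image)
    show "continuous_on C g" using g(1) \<D>(2) that by (auto intro: continuous_on_subset)
    show "compact C" using \<D>(3)[OF that] by auto
  qed
  then have "g ` C \<in> sets borel" if "C \<in> \<D>" for C using that by (auto intro: borel_closed compact_imp_closed)
  then have "(\<Union>C\<in>\<D>. g ` C) \<in> sets borel" using \<D>(1) by auto
  moreover have "inv_into S g -` U \<inter> space (restrict_space borel (g ` S)) = (\<Union>C\<in>\<D>. g ` C)"
  proof -
    have "inv_into S g -` U \<inter> g ` S = g ` (S \<inter> U)" using g(2) by (auto simp: image_iff)
    also have "\<dots> = (\<Union>C\<in>\<D>. g ` C)" unfolding \<D>(4)[symmetric] by auto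
    finally show ?thesis by (simp add: space_restrict_space)
  qed
  moreover have "(\<Union>C\<in>\<D>. g ` C) \<subseteq> g ` S" using \<D>(2) by auto
  ultimately show "inv_into S g -` U \<inter> space (restrict_space borel (g ` S)) \<in> sets (restrict_space borel (g ` S))"
    unfolding sets_restrict_space by (metis image_eqI inf.absorb_iff2)
qed

lemma subset_closure_of_AE:
  fixes S :: "'a::topological_space set"
  assumes S: "open S" and pos: "\<And>U. open U \<Longrightarrow> U \<subseteq> S \<Longrightarrow> U \<noteq> {} \<Longrightarrow> 0 < emeasure M U"
    and ae: "AE s in M. s \<in> G"
  shows "S \<subseteq> closure G"
proof (rule ccontr)
  assume "\<not> S \<subseteq> closure G"
  moreover define U where "U = S - closure G"
  ultimately have p: "0 < emeasure M U" using S by (intro pos) auto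
  then have "U \<in> sets M" using emeasure_notin_sets by fastforce
  moreover have "AE s in M. s \<notin> U" using ae by eventually_elim (use closure_subset in \<open>auto simp: U_def\<close>)
  ultimately have "U \<in> null_sets M" by (simp add: AE_iff_null_sets)
  with p show False by auto
qed

text \<open>The reflection \<open>t \<mapsto> 2 *\<^sub>R s - t\<close> preserves \<open>scaled_dist \<sigma> \<beta> s\<close>, and this determines the centre \<open>q\<close>.\<close>

lemma scaled_dist_centre_unique:
  fixes A :: "real^'n^'n"
  assumes \<beta>: "0 < \<beta>" and \<sigma>: "\<And>i. 0 < \<sigma> i" and S: "open S" "s \<in> S" and A: "generalized_permutation A"
    and eq: "\<And>t. t \<in> S \<Longrightarrow> scaled_dist \<sigma> \<beta> q (A *v t + b) = scaled_dist \<sigma> \<beta> s t + k"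
  shows "q = A *v s + b"
proof -
  obtain \<pi> c where \<pi>: "\<pi> permutes UNIV" and c: "\<And>i. c i \<noteq> 0" and A_eq: "A = (\<chi> i j. if j = \<pi> i then c i else 0)"
    using A unfolding generalized_permutation_def by blast
  have Ai: "(A *v x) $ i = c i * x $ \<pi> i" for x i
    unfolding A_eq by (rule matrix_vector_mult_generalized_permutation)
  obtain e where e: "0 < e" "ball s e \<subseteq> S" using openE[OF S] by metis
  define v where "v = q - (A *v s + b)"
  have "v $ i = 0" for i
  proof -
    \<comment> \<open>A move along axis \<open>\<pi> i\<close> changes only coordinate
      \<open>i\<close> after applying \<open>A\<close>, which isolates \<open>v $ i\<close>. The
      factor \<open>e / 2\<close> keeps \<open>s + u\<close> and \<open>s - u\<close> in the
      ball.\<close>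
    define u :: "real^'n" where "u = (e / 2) *\<^sub>R axis (\<pi> i) 1"
    have "norm u < e" using e by (simp add: u_def norm_axis_1)
    then have mem: "s + u \<in> S" "s - u \<in> S" using e by (auto intro!: subsetD[OF e(2)] simp: dist_norm)
    have "scaled_dist \<sigma> \<beta> s (s + u) = scaled_dist \<sigma> \<beta> s (s - u)" by (simp add: scaled_dist_def)
    then have "scaled_dist \<sigma> \<beta> q (A *v (s + u) + b) = scaled_dist \<sigma> \<beta> q (A *v (s - u) + b)"
      using eq[OF mem(1)] eq[OF mem(2)] by simp
    moreover have "scaled_dist \<sigma> \<beta> q (A *v (s + w) + b) =
        (\<bar>v $ i - c i * w $ \<pi> i\<bar> / \<sigma> i) powr \<beta> + (\<Sum>j\<in>UNIV - {i}. (\<bar>v $ j\<bar> / \<sigma> j) powr \<beta>)"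
      if "\<And>j. j \<noteq> \<pi> i \<Longrightarrow> w $ j = 0" for w
    proof -
      have "q $ j - (A *v (s + w) + b) $ j = v $ j - c j * w $ \<pi> j" for j
        by (simp add: v_def Ai algebra_simps)
      moreover have "w $ \<pi> j = 0" if "j \<noteq> i" for j
        using \<open>\<And>j. j \<noteq> \<pi> i \<Longrightarrow> w $ j = 0\<close> that permutes_inj[OF \<pi>] by (auto simp: inj_eq)
      ultimately show ?thesis
        unfolding scaled_dist_def by (subst sum.remove[of UNIV i]) (auto intro!: sum.cong)
    qed
    note this[of u] this[of "- u"]
    moreover have "u $ \<pi> i = e / 2" "\<And>j. j \<noteq> \<pi> i \<Longrightarrow> u $ j = 0" by (auto simp: u_def axis_def)
    ultimately have "(\<bar>v $ i - c i * (e / 2)\<bar> / \<sigma> i) powr \<beta> = (\<bar>v $ i + c i * (e / 2)\<bar> / \<sigma> i) powr \<beta>"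
      by simp
    from arg_cong[OF this, of "\<lambda>x. x powr (1 / \<beta>)"] \<beta> \<sigma>[of i]
    have "\<bar>v $ i - c i * (e / 2)\<bar> = \<bar>v $ i + c i * (e / 2)\<bar>" by (simp add: powr_powr)
    moreover have "c i * (e / 2) \<noteq> 0" using c e by simp
    ultimately show "v $ i = 0" by linarith
  qed
  then show ?thesis by (simp add: v_def vec_eq_iff)
qed

lemma identifiability:
  fixes h :: "real^'n \<Rightarrow> real^'n" and ps :: "(real^'n) measure"
  assumes \<beta>: "\<beta> \<in> {0<..<2} \<union> {2<..}" and \<sigma>: "\<And>i. 0 < \<sigma> i"
    and S: "open S" "connected S" and ps: "sets ps = sets (restrict_space borel S)"
    and ps_support: "\<And>U. open U \<Longrightarrow> U \<subseteq> S \<Longrightarrow> U \<noteq> {} \<Longrightarrow> 0 < emeasure ps U"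
    and h: "h \<in> borel_measurable (restrict_space borel S)"
    and ae: "AE s in ps. AE t in restrict_space lborel S.
      scaled_dist \<sigma> \<beta> (h s) (h t) = scaled_dist \<sigma> \<beta> s t + a s + b t"
  shows "\<exists>A c. generalized_permutation A \<and> (continuous_on S h \<longrightarrow> (\<forall>s\<in>S. h s = A *v s + c)) \<and>
      (absolutely_continuous ps (restrict_space lborel S) \<longrightarrow> (AE s in ps. h s = A *v s + c))"
proof -
  have \<beta>0: "0 < \<beta>" using \<beta> by auto
  define L where "L = restrict_space lborel S"
  define G where "G = {s \<in> S. AE t in L. scaled_dist \<sigma> \<beta> (h s) (h t) = scaled_dist \<sigma> \<beta> s t + a s + b t}"
  have space: "space L = S" "space ps = S"
    using sets_eq_imp_space_eq[OF ps] by (auto simp: L_def space_restrict_space)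
  have sets: "sets L = sets ps" unfolding L_def ps by (rule sets_restrict_space_cong) simp
  have psG: "AE s in ps. s \<in> G"
    using ae AE_space[of ps] unfolding L_def[symmetric] by eventually_elim (simp add: G_def space)
  have L_pos: "0 < emeasure L U" if "open U" "U \<subseteq> S" "U \<noteq> {}" for U
    using that S(1) by (simp add: L_def emeasure_restrict_space emeasure_lborel_open_pos)
  define Reg where "Reg = {s \<in> S. \<forall>U. open U \<longrightarrow> (s, h s) \<in> U \<longrightarrow> 0 < emeasure L ((\<lambda>t. (t, h t)) -` U \<inter> space L)}"
  have iso: "scaled_dist \<sigma> \<beta> (h s) (h s') = scaled_dist \<sigma> \<beta> s s'" if "s \<in> G \<inter> Reg" "s' \<in> G \<inter> Reg" for s s'
    by (rule scaled_dist_eq_of_AE[where M = L and a = "a s" and a' = "a s'" and b = b, OF \<beta>0 \<sigma>])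
       (use that in \<open>auto simp: G_def Reg_def\<close>)
  show ?thesis
  proof (cases "continuous_on S h")
    case True
    have "Reg = S"
      unfolding Reg_def L_def
      by (auto intro!: continuous_regular_point[OF S(1)] continuous_on_Pair continuous_on_id True)
    then have G: "G \<inter> Reg = G" by (auto simp: G_def)
    \<comment> \<open>Here density comes from \<open>ps\<close>, which charges every nonempty open
      subset of \<open>S\<close>.\<close>
    have dense: "S \<subseteq> closure G" by (rule subset_closure_of_AE[OF S(1) ps_support psG])
    have "G \<subseteq> S" by (auto simp: G_def)
    from scaled_dist_isometry_dense[where \<sigma> = \<sigma>, OF \<beta> \<sigma> S this dense iso[unfolded G]]
    obtain A c where A: "generalized_permutation A" and hG: "\<And>s. s \<in> G \<Longrightarrow> h s = A *v s + c" by blast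
    have "h s = A *v s + c" if s: "s \<in> S" for s
    proof -
      obtain x where x: "\<And>n. x n \<in> G" "x \<longlonglongrightarrow> s" using dense s closure_sequential by (metis subsetD)
      have "(\<lambda>n. h (x n)) \<longlonglongrightarrow> h s"
        using True x s \<open>G \<subseteq> S\<close> unfolding continuous_on_sequentially by (auto simp: o_def)
      moreover have "(\<lambda>n. h (x n)) \<longlonglongrightarrow> A *v s + c"
        unfolding hG[OF x(1)] by (intro tendsto_intros x(2) bounded_linear.tendsto[OF matrix_vector_mul_bounded_linear])
      ultimately show ?thesis by (rule LIMSEQ_unique)
    qed
    moreover from this have "AE s in ps. h s = A *v s + c" by (intro AE_I2) (simp add: space)
    ultimately show ?thesis using A by blast
  next
    case discont: False
    show ?thesis
    proof (cases "absolutely_continuous ps L")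
      case False
      \<comment> \<open>Both implications are vacuous in this case; the identity, being an isometry,
        supplies some matrix.\<close>
      obtain A :: "real^'n^'n" where "generalized_permutation A"
        using scaled_dist_isometry_open[where \<sigma> = \<sigma> and h = "\<lambda>x. x", OF \<beta> \<sigma> S] by blast
      with False discont show ?thesis unfolding L_def by blast
    next
      case True
      \<comment> \<open>\<open>absolutely_continuous ps L\<close> says that \<open>ps\<close>-null
        sets are Lebesgue null, so a condition on anchors passes from \<open>ps\<close> to
        \<open>L\<close>.\<close>
      have LG: "AE s in L. s \<in> G" using True psG by (rule absolutely_continuous_AE[OF sets])
      have "(\<lambda>t. t) \<in> borel_measurable L" unfolding L_def by (rule measurable_restrict_space1) simp
      moreover have "h \<in> borel_measurable L" using h sets ps by (simp cong: measurable_cong_sets)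
      ultimately have "(\<lambda>t. (t, h t)) \<in> borel_measurable L" by (rule borel_measurable_Pair)
      from AE_regular_point[OF this] AE_space[of L] have "AE s in L. s \<in> Reg"
        by eventually_elim (auto simp: Reg_def space)
      with LG have LGR: "AE s in L. s \<in> G \<inter> Reg" by eventually_elim simp
      have dense: "S \<subseteq> closure (G \<inter> Reg)" by (rule subset_closure_of_AE[OF S(1) L_pos LGR])
      have "G \<inter> Reg \<subseteq> S" by (auto simp: G_def)
      from scaled_dist_isometry_dense[where \<sigma> = \<sigma>, OF \<beta> \<sigma> S this dense iso]
      obtain A c where A: "generalized_permutation A" and hG: "\<And>s. s \<in> G \<inter> Reg \<Longrightarrow> h s = A *v s + c" by blast
      \<comment> \<open>The points of \<open>G\<close> outside \<open>Reg\<close> form a Lebesgue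
        null set that may carry mass of \<open>ps\<close>. The affine form at almost all
        \<open>t\<close> determines \<open>h s\<close> there as the centre of a distance
        function.\<close>
      have "h s = A *v s + c" if s: "s \<in> G" for s
      proof -
        have "s \<in> S" using s by (simp add: G_def)
        then have "G \<inter> Reg \<noteq> {}" using dense by auto
        then obtain s0 where s0: "s0 \<in> G" "s0 \<in> Reg" by auto
        \<comment> \<open>The second anchor \<open>s0\<close> is regular, so distances from it to
          almost all \<open>t\<close> are preserved. This gives \<open>a s0 + b t = 0\<close> and
          removes the unknown \<open>b\<close>.\<close>
        have "AE t in L. scaled_dist \<sigma> \<beta> (h s0) (h t) = scaled_dist \<sigma> \<beta> s0 t + a s0 + b t"
          "AE t in L. scaled_dist \<sigma> \<beta> (h s) (h t) = scaled_dist \<sigma> \<beta> s t + a s + b t"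
          using s s0 by (auto simp: G_def)
        with LGR have AE: "AE t in L. scaled_dist \<sigma> \<beta> (h s) (A *v t + c) - scaled_dist \<sigma> \<beta> s t = a s - a s0"
        proof eventually_elim
          case (elim t)
          then show ?case using iso[of s0 t] s0 hG[of t] by simp
        qed
        have cont: "continuous_on UNIV (\<lambda>t. scaled_dist \<sigma> \<beta> (h s) (A *v t + c) - scaled_dist \<sigma> \<beta> s t)"
          by (intro continuous_on_diff continuous_on_scaled_dist \<beta>0 \<sigma> continuous_intros matrix_vector_mult_linear_continuous_on)
        have "scaled_dist \<sigma> \<beta> (h s) (A *v t + c) = scaled_dist \<sigma> \<beta> s t + (a s - a s0)" if "t \<in> S" for t
        proof -
          have "0 < emeasure L ((\<lambda>t. t) -` U \<inter> space L)" if "open U" "t \<in> U" for U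
            unfolding L_def by (rule continuous_regular_point[OF S(1) continuous_on_id \<open>t \<in> S\<close> that])
          then have "scaled_dist \<sigma> \<beta> (h s) (A *v t + c) - scaled_dist \<sigma> \<beta> s t = a s - a s0"
            by (rule regular_point_eq[where k = "\<lambda>t. t" and s = t, OF _ cont AE])
          then show ?thesis by simp
        qed
        from scaled_dist_centre_unique[where \<sigma> = \<sigma>, OF \<beta>0 \<sigma> S(1) \<open>s \<in> S\<close> A this] show ?thesis .
      qed
      then have "AE s in ps. h s = A *v s + c" using psG by (auto elim: eventually_mono)
      with A discont show ?thesis by blast
    qed
  qed
qed

section \<open>The latent variable model\<close>

lemma estimators_mono:
  assumes "A \<subseteq> B"
  shows "estimators X A d \<subseteq> estimators X B d"
  using subsetD[OF assms] unfolding estimators_def by (auto intro: bexI[rotated])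

lemma borel_measurable_scaled_dist:
  fixes f h :: "'a \<Rightarrow> real^'n"
  assumes "0 < \<beta>" "\<And>i. 0 < \<sigma> i" "f \<in> borel_measurable M" "h \<in> borel_measurable M"
  shows "(\<lambda>x. scaled_dist \<sigma> \<beta> (f x) (h x)) \<in> borel_measurable M"
proof (rule borel_measurable_continuous_Pair[OF assms(3,4)])
  show "continuous_on UNIV (\<lambda>x. scaled_dist \<sigma> \<beta> (fst x) (snd x))"
    using assms(1,2) by (rule continuous_on_scaled_dist) (auto intro: continuous_intros)
qed

locale latent_model =
  fixes S :: "(real^'n::finite) set" and X :: "(real^'m::finite) set" and g :: "real^'n \<Rightarrow> real^'m"
    and ps :: "(real^'n) measure" and pneg :: "(real^'m) measure"
    and Q :: "real^'n \<Rightarrow> real" and \<sigma> :: "'n \<Rightarrow> real" and \<beta> :: real and w :: "real^'m \<Rightarrow> real"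
  assumes S: "open S" and g: "bij_betw g S X" "continuous_on S g"
    and \<beta>: "0 < \<beta>" and \<sigma>: "\<And>i. 0 < \<sigma> i"
    and ps: "prob_space ps" "sets ps = sets (restrict_space borel S)"
    and Q: "Q \<in> borel_measurable (restrict_space borel S)" "\<And>t. t \<in> S \<Longrightarrow> 0 < Q t"
    and Z: "\<And>s. s \<in> S \<Longrightarrow> 0 < partition_fn S Q (scaled_dist \<sigma> \<beta>) s"
    and pneg: "prob_space pneg"
      "pneg = density (obs_marginal X g (restrict_space lborel S)) (\<lambda>x. ennreal (w x))"
    and w: "w \<in> borel_measurable (restrict_space borel X)" "\<And>x. x \<in> X \<Longrightarrow> 0 < w x"
begin

abbreviation "d \<equiv> scaled_dist \<sigma> \<beta>"
abbreviation "L \<equiv> restrict_space lborel S"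
abbreviation "BX \<equiv> restrict_space borel X"
abbreviation "px \<equiv> obs_marginal X g ps"
abbreviation "ppos \<equiv> obs_pos X g (latent_pos S ps Q d)"

definition inverse_g :: "real^'m \<Rightarrow> real^'n" where "inverse_g = inv_into S g"

text \<open>With the encoder \<open>inverse_g\<close>, the terms \<open>alpha\<close> and
  \<open>alpha'\<close> make \<open>exp (- \<delta>)\<close> the density of positive against
  negative pairs. The value 0 off \<open>S\<close> keeps both Borel on the whole latent
  space.\<close>

definition alpha :: "real^'n \<Rightarrow> real" where
  "alpha s = (if s \<in> S then ln (partition_fn S Q d s) else 0)"

definition alpha' :: "real^'n \<Rightarrow> real" where
  "alpha' t = (if t \<in> S then ln (w (g t)) - ln (Q t) else 0)"

definition neg_log_ratio :: "(real^'m) \<times> (real^'m) \<Rightarrow> real" where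
  "neg_log_ratio = (\<lambda>(x, y). d (inverse_g x) (inverse_g y) + alpha (inverse_g x) + alpha' (inverse_g y))"

lemma sets_L: "sets L = sets (restrict_space borel S)"
  by (rule sets_restrict_space_cong) simp

lemma space_L [simp]: "space L = S" and space_ps [simp]: "space ps = S"
  using sets_eq_imp_space_eq[OF ps(2)] by (simp_all add: space_restrict_space)

lemma gX: "s \<in> S \<Longrightarrow> g s \<in> X"
  using g(1) by (auto simp: bij_betw_def)

lemma inverse_g [simp]: "s \<in> S \<Longrightarrow> inverse_g (g s) = s"
  using g(1) by (simp add: inverse_g_def bij_betw_def)

lemma measurable_g [measurable]: "g \<in> measurable (restrict_space borel S) BX"
  using g(2) gX by (intro measurable_restrict_space2 borel_measurable_continuous_on_restrict)
    (auto simp: space_restrict_space)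

lemma measurable_g_ps [measurable]: "g \<in> measurable ps BX"
  using measurable_g ps(2) by (simp cong: measurable_cong_sets)

lemma measurable_g_L [measurable]: "g \<in> measurable L BX"
  using measurable_g sets_L by (simp cong: measurable_cong_sets)

lemma measurable_inverse_g [measurable]: "inverse_g \<in> borel_measurable BX"
  using borel_measurable_inv_into_continuous[OF S g(2)] g(1) by (auto simp: inverse_g_def bij_betw_def)

lemma sets_px [measurable_cong]: "sets px = sets BX" and sets_pneg [measurable_cong]: "sets pneg = sets BX"
  by (simp_all add: pneg(2) obs_marginal_def)

lemma measurable_id_L: "(\<lambda>t. t) \<in> borel_measurable L"
  by (rule measurable_restrict_space1) simp

lemma measurable_id_ps: "(\<lambda>t. t) \<in> borel_measurable ps"
  using measurable_id_L sets_L ps(2) by (simp cong: measurable_cong_sets)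

lemma Q_L [measurable]: "Q \<in> borel_measurable L"
  using Q(1) sets_L by (simp cong: measurable_cong_sets)

lemma sigma_finite_L: "sigma_finite_measure L"
  using S by (intro sigma_finite_measure_restrict_space sigma_finite_lborel) auto

lemma measurable_kernel:
  "(\<lambda>(s, t). Q t * exp (- d s t)) \<in> borel_measurable (ps \<Otimes>\<^sub>M L)"
proof -
  have [measurable]: "(\<lambda>z. fst z) \<in> borel_measurable (ps \<Otimes>\<^sub>M L)" "(\<lambda>z. snd z) \<in> borel_measurable (ps \<Otimes>\<^sub>M L)"
    using measurable_compose[OF measurable_fst measurable_id_ps] measurable_compose[OF measurable_snd measurable_id_L] by auto
  have [measurable]: "(\<lambda>z. d (fst z) (snd z)) \<in> borel_measurable (ps \<Otimes>\<^sub>M L)"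
    by (rule borel_measurable_scaled_dist[OF \<beta> \<sigma>]) measurable
  show ?thesis unfolding split_beta' by measurable
qed

lemma partition_fn_eq: "partition_fn S Q d s = (\<integral>t. Q t * exp (- d s t) \<partial>L)"
  using S by (subst integral_restrict_space) (auto simp: partition_fn_def set_lebesgue_integral_def)

lemma measurable_partition_fn: "partition_fn S Q d \<in> borel_measurable ps"
  unfolding partition_fn_eq
  by (rule sigma_finite_measure.borel_measurable_lebesgue_integral[OF sigma_finite_L measurable_kernel])

lemma measurable_cond_density:
  "(\<lambda>(s, t). Q t / partition_fn S Q d s * exp (- d s t)) \<in> borel_measurable (ps \<Otimes>\<^sub>M L)"
proof -
  have "(\<lambda>z. (case z of (s, t) \<Rightarrow> Q t * exp (- d s t)) / partition_fn S Q d (fst z)) \<in> borel_measurable (ps \<Otimes>\<^sub>M L)"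
    by (rule borel_measurable_divide[OF measurable_kernel measurable_compose[OF measurable_fst measurable_partition_fn]])
  then show ?thesis by (simp add: split_beta')
qed

lemma measurable_alpha [measurable]: "alpha \<in> borel_measurable borel"
proof -
  have "partition_fn S Q d \<in> borel_measurable (restrict_space borel S)"
    using measurable_partition_fn ps(2) by (simp cong: measurable_cong_sets)
  then show ?thesis
    unfolding alpha_def[abs_def] using S by (subst measurable_If_restrict_space_iff) auto
qed

lemma measurable_alpha' [measurable]: "alpha' \<in> borel_measurable borel"
proof -
  have [measurable]: "(\<lambda>t. w (g t)) \<in> borel_measurable (restrict_space borel S)"
    by (rule measurable_compose[OF measurable_g w(1)])
  show ?thesis
    unfolding alpha'_def[abs_def] using S Q(1) by (subst measurable_If_restrict_space_iff) auto
qed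

lemma measurable_estimator:
  assumes f[measurable]: "f \<in> borel_measurable BX"
    and [measurable]: "a \<in> borel_measurable borel" "b \<in> borel_measurable borel"
  shows "(\<lambda>z. d (f (fst z)) (f (snd z)) + a (f (fst z)) + b (f (snd z))) \<in> borel_measurable (px \<Otimes>\<^sub>M pneg)"
proof -
  have [measurable]: "(\<lambda>z. d (f (fst z)) (f (snd z))) \<in> borel_measurable (px \<Otimes>\<^sub>M pneg)"
    by (rule borel_measurable_scaled_dist[OF \<beta> \<sigma>]) measurable
  show ?thesis by measurable
qed

lemma measurable_neg_log_ratio [measurable]: "neg_log_ratio \<in> borel_measurable (px \<Otimes>\<^sub>M pneg)"
  unfolding neg_log_ratio_def split_beta' by (rule measurable_estimator) measurable

lemma exp_neg_log_ratio:
  assumes "s \<in> S" "t \<in> S"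
  shows "exp (- neg_log_ratio (g s, g t)) = Q t / (partition_fn S Q d s * w (g t)) * exp (- d s t)"
  using assms Q(2)[of t] Z[of s] w(2)[OF gX[of t]]
  by (simp add: neg_log_ratio_def alpha_def alpha'_def exp_add exp_minus exp_diff field_simps)

lemma prob_space_latent_pos: "prob_space (latent_pos S ps Q d)"
proof (rule prob_spaceI)
  interpret ps: prob_space ps by (rule ps)
  interpret L: sigma_finite_measure L by (rule sigma_finite_L)
  have k: "(\<lambda>(s, t). ennreal (Q t / partition_fn S Q d s * exp (- d s t))) \<in> borel_measurable (ps \<Otimes>\<^sub>M L)"
    using measurable_compose[OF measurable_cond_density measurable_ennreal] by (simp add: split_beta')
  have "emeasure (latent_pos S ps Q d) (space (latent_pos S ps Q d)) =
      (\<integral>\<^sup>+ z. (case z of (s, t) \<Rightarrow> ennreal (Q t / partition_fn S Q d s * exp (- d s t))) \<partial>(ps \<Otimes>\<^sub>M L))"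
    unfolding latent_pos_def using k by (simp add: emeasure_density nn_set_integral_space)
  also have "\<dots> = (\<integral>\<^sup>+ s. \<integral>\<^sup>+ t. ennreal (Q t / partition_fn S Q d s * exp (- d s t)) \<partial>L \<partial>ps)"
    by (subst L.nn_integral_fst[OF k, symmetric]) simp
  also have "\<dots> = (\<integral>\<^sup>+ s. 1 \<partial>ps)"
  proof (rule nn_integral_cong)
    fix s assume "s \<in> space ps"
    then have Zs: "0 < partition_fn S Q d s" using Z by simp
    have int: "integrable L (\<lambda>t. Q t * exp (- d s t))"
      using Zs not_integrable_integral_eq unfolding partition_fn_eq by fastforce
    have "(\<integral>\<^sup>+ t. ennreal (Q t / partition_fn S Q d s * exp (- d s t)) \<partial>L) =
        (\<integral>\<^sup>+ t. ennreal ((Q t * exp (- d s t)) / partition_fn S Q d s) \<partial>L)" by simp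
    also have "\<dots> = ennreal (\<integral> t. (Q t * exp (- d s t)) / partition_fn S Q d s \<partial>L)"
      using int Q(2) Zs by (intro nn_integral_eq_integral) (auto intro!: AE_I2 divide_nonneg_pos mult_nonneg_nonneg simp: less_imp_le)
    also have "\<dots> = 1" using Zs by (simp add: partition_fn_eq[symmetric])
    finally show "(\<integral>\<^sup>+ t. ennreal (Q t / partition_fn S Q d s * exp (- d s t)) \<partial>L) = 1" .
  qed
  finally show "emeasure (latent_pos S ps Q d) (space (latent_pos S ps Q d)) = 1"
    using ps.emeasure_space_1 by simp
qed

lemma prob_space_px: "prob_space px"
  unfolding obs_marginal_def by (rule prob_space.prob_space_distr[OF ps(1) measurable_g_ps])

text \<open>With respect to the product of \<open>px\<close> and the image of Lebesgue measure,
  positive pairs have the conditional latent density transported by \<open>g\<close>. Passing to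
  \<open>pneg\<close> in the second factor divides it by \<open>w\<close>.\<close>

lemma ppos_eq: "ppos = density (px \<Otimes>\<^sub>M pneg) (\<lambda>z. ennreal (exp (- neg_log_ratio z)))"
proof -
  define R where "R = distr L BX g"
  have pneg_R: "pneg = density R (\<lambda>x. ennreal (w x))" by (simp add: pneg(2) R_def obs_marginal_def)
  have w_R[measurable]: "w \<in> borel_measurable R" using w(1) by (simp add: R_def)
  interpret px: prob_space px by (rule prob_space_px)
  interpret pneg: prob_space pneg by (rule pneg)
  \<comment> \<open>An image of a sigma-finite measure need not be sigma-finite. \<open>R\<close>
    is, because it has the finite density \<open>1 / w\<close> with respect to a probability
    measure.\<close>
  have "density pneg (\<lambda>x. ennreal (1 / w x)) = density R (\<lambda>x. ennreal (w x) * ennreal (1 / w x))"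
    unfolding pneg_R by (rule density_density_eq) auto
  also have "\<dots> = density R (\<lambda>_. 1)"
  proof (rule density_cong)
    have "ennreal (w x) * ennreal (1 / w x) = 1" if "x \<in> space R" for x
      using w(2)[of x] that by (simp add: R_def space_restrict_space ennreal_mult[symmetric])
    then show "AE x in R. ennreal (w x) * ennreal (1 / w x) = 1" by auto
  qed auto
  finally have R_eq: "R = density pneg (\<lambda>x. ennreal (1 / w x))" by (simp add: density_1)
  have sf_R: "sigma_finite_measure R"
    unfolding R_eq using w(1) sets_pneg
    by (subst pneg.sigma_finite_iff_density_finite) (auto cong: measurable_cong_sets)
  have px_pneg: "px \<Otimes>\<^sub>M pneg = density (px \<Otimes>\<^sub>M R) (\<lambda>z. ennreal (w (snd z)))"
  proof -
    have "density px (\<lambda>_. 1) \<Otimes>\<^sub>M density R (\<lambda>x. ennreal (w x)) = density (px \<Otimes>\<^sub>M R) (\<lambda>(x, y). 1 * ennreal (w y))"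
      using sf_R pneg.sigma_finite_measure_axioms pneg_R by (intro pair_measure_density) auto
    then show ?thesis by (simp add: density_1 pneg_R[symmetric] split_beta')
  qed
  have px_R: "px \<Otimes>\<^sub>M R = distr (ps \<Otimes>\<^sub>M L) (BX \<Otimes>\<^sub>M BX) (map_prod g g)"
    using pair_measure_distr[OF measurable_g_ps measurable_g_L sf_R[unfolded R_def]]
    unfolding R_def obs_marginal_def map_prod_def .
  have sets_XR: "sets (px \<Otimes>\<^sub>M R) = sets (BX \<Otimes>\<^sub>M BX)" by (simp add: R_def sets_px cong: sets_pair_measure_cong)
  have nlr: "neg_log_ratio \<in> borel_measurable (BX \<Otimes>\<^sub>M BX)"
    using measurable_neg_log_ratio by (simp add: sets_px sets_pneg cong: measurable_cong_sets sets_pair_measure_cong)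
  have W[measurable]: "(\<lambda>z. ennreal (w (snd z)) * ennreal (exp (- neg_log_ratio z))) \<in> borel_measurable (BX \<Otimes>\<^sub>M BX)"
    using nlr w(1) by measurable
  have gg: "map_prod g g \<in> measurable (ps \<Otimes>\<^sub>M L) (BX \<Otimes>\<^sub>M BX)"
    unfolding map_prod_def by measurable
  have "density (px \<Otimes>\<^sub>M pneg) (\<lambda>z. ennreal (exp (- neg_log_ratio z))) =
      density (px \<Otimes>\<^sub>M R) (\<lambda>z. ennreal (w (snd z)) * ennreal (exp (- neg_log_ratio z)))"
    unfolding px_pneg using nlr w(1) sets_XR by (intro density_density_eq) (auto cong: measurable_cong_sets)
  also have "\<dots> = distr (density (ps \<Otimes>\<^sub>M L) (\<lambda>z. ennreal (w (snd (map_prod g g z))) * ennreal (exp (- neg_log_ratio (map_prod g g z)))))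
      (BX \<Otimes>\<^sub>M BX) (map_prod g g)"
    unfolding px_R by (rule density_distr[OF W gg])
  also have "density (ps \<Otimes>\<^sub>M L) (\<lambda>z. ennreal (w (snd (map_prod g g z))) * ennreal (exp (- neg_log_ratio (map_prod g g z))))
      = latent_pos S ps Q d"
    unfolding latent_pos_def
  proof (rule density_cong)
    show "(\<lambda>z. ennreal (w (snd (map_prod g g z))) * ennreal (exp (- neg_log_ratio (map_prod g g z)))) \<in> borel_measurable (ps \<Otimes>\<^sub>M L)"
      by (rule measurable_compose[OF gg W])
    show "(\<lambda>(s, t). ennreal (Q t / partition_fn S Q d s * exp (- d s t))) \<in> borel_measurable (ps \<Otimes>\<^sub>M L)"
      using measurable_compose[OF measurable_cond_density measurable_ennreal] by (simp add: split_beta')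
    show "AE z in ps \<Otimes>\<^sub>M L. ennreal (w (snd (map_prod g g z))) * ennreal (exp (- neg_log_ratio (map_prod g g z))) =
        (case z of (s, t) \<Rightarrow> ennreal (Q t / partition_fn S Q d s * exp (- d s t)))"
    proof (rule AE_I2)
      fix z assume "z \<in> space (ps \<Otimes>\<^sub>M L)"
      then obtain s t where z: "z = (s, t)" "s \<in> S" "t \<in> S" by (auto simp: space_pair_measure)
      have "w (g t) * exp (- neg_log_ratio (g s, g t)) = Q t / partition_fn S Q d s * exp (- d s t)"
        using w(2)[OF gX[OF z(3)]] by (simp add: exp_neg_log_ratio z)
      then show "ennreal (w (snd (map_prod g g z))) * ennreal (exp (- neg_log_ratio (map_prod g g z))) =
        (case z of (s, t) \<Rightarrow> ennreal (Q t / partition_fn S Q d s * exp (- d s t)))"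
        using w(2)[OF gX[OF z(3)]] by (simp add: z(1) ennreal_mult'[symmetric])
    qed
  qed
  finally show ?thesis by (simp add: obs_pos_def)
qed

lemma prob_space_ppos: "prob_space ppos"
  unfolding obs_pos_def
proof (rule prob_space.prob_space_distr[OF prob_space_latent_pos])
  have "map_prod g g \<in> measurable (ps \<Otimes>\<^sub>M L) (BX \<Otimes>\<^sub>M BX)" unfolding map_prod_def by measurable
  then show "map_prod g g \<in> measurable (latent_pos S ps Q d) (BX \<Otimes>\<^sub>M BX)" by (simp add: latent_pos_def)
qed

end

sublocale latent_model \<subseteq> ratio: density_ratio "obs_marginal X g ps \<Otimes>\<^sub>M pneg" neg_log_ratio "obs_pos X g (latent_pos S ps Q (scaled_dist \<sigma> \<beta>))"
proof -
  interpret px: prob_space px by (rule prob_space_px)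
  interpret pneg: prob_space pneg by (rule pneg)
  interpret pair_prob_space px pneg ..
  show "density_ratio (obs_marginal X g ps \<Otimes>\<^sub>M pneg) neg_log_ratio (obs_pos X g (latent_pos S ps Q (scaled_dist \<sigma> \<beta>)))"
    by (intro density_ratio.intro density_ratio_axioms.intro prob_space_axioms measurable_neg_log_ratio ppos_eq prob_space_ppos)
qed

section \<open>Optimal estimators of the model\<close>

context latent_model
begin

text \<open>Positivity of \<open>w\<close> makes null sets of \<open>pneg\<close> null for the image
  of Lebesgue measure, so the equation pulls back along \<open>g\<close>. Terms in the anchor alone
  are collected in the new \<open>a\<close>, terms in the partner alone in \<open>b\<close>.\<close>

lemma AE_pos_imp_AE_latent:
  fixes f :: "real^'m \<Rightarrow> real^'n"
  assumes ae: "AE z in px \<Otimes>\<^sub>M pneg.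
      d (f (fst z)) (f (snd z)) + \<alpha> (f (fst z)) + \<alpha>' (f (snd z)) = neg_log_ratio z + a (fst z)"
  shows "\<exists>a b. AE s in ps. AE t in L. d (f (g s)) (f (g t)) = d s t + a s + b t"
proof -
  let ?P = "\<lambda>x y. d (f x) (f y) + \<alpha> (f x) + \<alpha>' (f y) = neg_log_ratio (x, y) + a x"
  interpret px: prob_space px by (rule prob_space_px)
  interpret pneg: prob_space pneg by (rule pneg)
  interpret pair_prob_space px pneg ..
  have "AE x in px. AE y in pneg. ?P x y"
    using AE_pair[OF ae] by simp
  then have "AE s in ps. AE y in pneg. ?P (g s) y"
    unfolding obs_marginal_def by (rule AE_distrD[OF measurable_g_ps])
  then have "AE s in ps. AE t in L. d (f (g s)) (f (g t)) =
      d s t + (alpha s + a (g s) - \<alpha> (f (g s))) + (alpha' t - \<alpha>' (f (g t)))"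
    using AE_space[of ps]
  proof eventually_elim
    case (elim s)
    define R where "R = distr L BX g"
    have pneg_R: "pneg = density R (\<lambda>x. ennreal (w x))" by (simp only: pneg(2) R_def obs_marginal_def)
    have "AE y in density R (\<lambda>x. ennreal (w x)). ?P (g s) y"
      using elim(1) by (simp only: pneg_R)
    then have "AE y in R. 0 < ennreal (w y) \<longrightarrow> ?P (g s) y"
      using w(1) by (subst (asm) AE_density) (auto simp: R_def)
    then have "AE t in L. 0 < ennreal (w (g t)) \<longrightarrow> ?P (g s) (g t)"
      unfolding R_def by (rule AE_distrD[OF measurable_g_L])
    with AE_space[of L] show ?case
    proof eventually_elim
      case (elim t)
      then have "?P (g s) (g t)" using w(2)[OF gX[of t]] by simp
      then show ?case using elim(1) \<open>s \<in> space ps\<close> by (simp add: neg_log_ratio_def)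
    qed
  qed
  then show ?thesis by (intro exI[of _ "\<lambda>s. alpha s + a (g s) - \<alpha> (f (g s))"] exI[of _ "\<lambda>t. alpha' t - \<alpha>' (f (g t))"])
qed

lemma estimators_inverse_g:
  assumes "a \<in> A" "b \<in> borel_measurable borel"
  shows "(inverse_g, \<lambda>z z'. d z z' + a z + b z') \<in> estimators X A d"
  using assms by (auto simp: estimators_def)

lemma optimal_imp_AE_latent:
  assumes K: "1 \<le> K" and optimal:
    "is_optimal (NCE_loss ppos px pneg) (estimators X (borel_measurable borel) d) (f, \<delta>)
     \<or> is_optimal (INCE_loss K ppos pneg) (estimators X {\<lambda>_. 0} d) (f, \<delta>)
     \<or> is_optimal (SCL_loss ppos px pneg) (estimators X (borel_measurable borel) d) (f, \<delta>)
     \<or> is_optimal (NWJ_loss ppos px pneg) (estimators X (borel_measurable borel) d) (f, \<delta>)"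
  shows "f \<in> borel_measurable BX" and "\<exists>a b. AE s in ps. AE t in L. d (f (g s)) (f (g t)) = d s t + a s + b t"
proof -
  have "estimators X {\<lambda>_. 0} d \<subseteq> estimators X (borel_measurable borel) d"
    by (rule estimators_mono) auto
  with optimal have "(f, \<delta>) \<in> estimators X (borel_measurable borel) d"
    by (auto simp: is_optimal_def)
  then obtain \<alpha> \<alpha>' where f: "f \<in> borel_measurable BX"
    and \<alpha>: "\<alpha> \<in> borel_measurable borel" "\<alpha>' \<in> borel_measurable borel"
    and \<delta>: "\<delta> = (\<lambda>z z'. d z z' + \<alpha> z + \<alpha>' z')"
    by (auto simp: estimators_def)
  show "f \<in> borel_measurable BX" by (rule f)
  define D where "D z = d (f (fst z)) (f (snd z)) + \<alpha> (f (fst z)) + \<alpha>' (f (snd z))" for z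
  have D: "D \<in> borel_measurable (px \<Otimes>\<^sub>M pneg)"
    unfolding D_def by (rule measurable_estimator[OF f \<alpha>])
  \<comment> \<open>The competitors for the spectral loss. \<open>alpha\<close> and
    \<open>alpha'\<close> are truncated separately, since truncating their sum would leave the form
    \<open>d + \<alpha> + \<alpha>'\<close>; with \<open>d \<ge> 0\<close> this gives the lower
    bound \<open>- 2 * n\<close>.\<close>
  define En where "En n z = d (inverse_g (fst z)) (inverse_g (snd z)) + max (alpha (inverse_g (fst z))) (- real n)
      + max (alpha' (inverse_g (snd z))) (- real n)" for n z
  have nlr: "neg_log_ratio z = d (inverse_g (fst z)) (inverse_g (snd z)) + alpha (inverse_g (fst z)) + alpha' (inverse_g (snd z))" for z
    by (simp add: neg_log_ratio_def split_beta')
  define ref where "ref = (inverse_g, \<lambda>z z'. d z z' + alpha z + alpha' z')"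
  have ref: "ref \<in> estimators X (borel_measurable borel) d"
    unfolding ref_def by (rule estimators_inverse_g) auto
  note unfold = D_def nlr ref_def \<delta> split_beta' prod.case
  have "\<exists>a. AE z in px \<Otimes>\<^sub>M pneg. D z = neg_log_ratio z + a (fst z)"
    using optimal
  proof (elim disjE)
    assume "is_optimal (NCE_loss ppos px pneg) (estimators X (borel_measurable borel) d) (f, \<delta>)"
    then have o: "\<bar>NCE_loss ppos px pneg (f, \<delta>)\<bar> \<noteq> \<infinity>" "NCE_loss ppos px pneg (f, \<delta>) \<le> NCE_loss ppos px pneg ref"
      using ref by (auto simp: is_optimal_def)
    have "AE z in px \<Otimes>\<^sub>M pneg. D z = neg_log_ratio z"
      by (rule ratio.NCE_minimizer[OF D]) (use o in \<open>simp_all add: NCE_loss_def unfold\<close>)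
    then show ?thesis by (intro exI[of _ "\<lambda>_. 0"]) simp
  next
    assume "is_optimal (NWJ_loss ppos px pneg) (estimators X (borel_measurable borel) d) (f, \<delta>)"
    then have o: "\<bar>NWJ_loss ppos px pneg (f, \<delta>)\<bar> \<noteq> \<infinity>" "NWJ_loss ppos px pneg (f, \<delta>) \<le> NWJ_loss ppos px pneg ref"
      using ref by (auto simp: is_optimal_def)
    have "AE z in px \<Otimes>\<^sub>M pneg. D z = neg_log_ratio z"
      by (rule ratio.NWJ_minimizer[OF D]) (use o in \<open>simp_all add: NWJ_loss_def unfold[abs_def]\<close>)
    then show ?thesis by (intro exI[of _ "\<lambda>_. 0"]) simp
  next
    assume "is_optimal (SCL_loss ppos px pneg) (estimators X (borel_measurable borel) d) (f, \<delta>)"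
    then have o: "\<bar>SCL_loss ppos px pneg (f, \<delta>)\<bar> \<noteq> \<infinity>"
      "e \<in> estimators X (borel_measurable borel) d \<Longrightarrow> SCL_loss ppos px pneg (f, \<delta>) \<le> SCL_loss ppos px pneg e" for e
      by (auto simp: is_optimal_def)
    have m: "(\<lambda>z. max (alpha z) (- real n)) \<in> borel_measurable borel" "(\<lambda>z. max (alpha' z) (- real n)) \<in> borel_measurable borel" for n
      by auto
    have "AE z in px \<Otimes>\<^sub>M pneg. D z = neg_log_ratio z"
    proof (rule ratio.SCL_minimizer[OF D, where En = En and C = "\<lambda>n. - 2 * real n"])
      show "En n \<in> borel_measurable (px \<Otimes>\<^sub>M pneg)" for n
        unfolding En_def by (rule measurable_estimator[OF measurable_inverse_g m])
      show "\<bar>ext_expectation ppos (\<lambda>z. - 2 * exp (- D z)) + ext_expectation (px \<Otimes>\<^sub>M pneg) (\<lambda>z. exp (- 2 * D z))\<bar> \<noteq> \<infinity>"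
        using o(1) by (simp add: SCL_loss_def unfold)
      show "ext_expectation ppos (\<lambda>z. - 2 * exp (- D z)) + ext_expectation (px \<Otimes>\<^sub>M pneg) (\<lambda>z. exp (- 2 * D z))
          \<le> ext_expectation ppos (\<lambda>z. - 2 * exp (- En n z)) + ext_expectation (px \<Otimes>\<^sub>M pneg) (\<lambda>z. exp (- 2 * En n z))" for n
        using o(2)[OF estimators_inverse_g[OF m[of n]]] by (simp add: SCL_loss_def En_def unfold)
      show "- 2 * real n \<le> En n z" for n z
        using scaled_dist_nonneg[of \<sigma> \<beta> "inverse_g (fst z)" "inverse_g (snd z)"] by (simp add: En_def)
      show "En (Suc n) z \<le> En n z" for n z
        unfolding En_def by (intro add_mono) auto
      show "(\<lambda>n. En n z) \<longlonglongrightarrow> neg_log_ratio z" for z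
      proof (rule tendsto_eventually)
        obtain N where N: "- alpha (inverse_g (fst z)) \<le> real N" "- alpha' (inverse_g (snd z)) \<le> real N"
          using real_arch_simple[of "max (- alpha (inverse_g (fst z))) (- alpha' (inverse_g (snd z)))"] by auto
        show "\<forall>\<^sub>F n in sequentially. En n z = neg_log_ratio z"
          using eventually_ge_at_top[of N]
        proof eventually_elim
          case (elim n)
          then have "real N \<le> real n" by simp
          with N have "max (alpha (inverse_g (fst z))) (- real n) = alpha (inverse_g (fst z))"
            "max (alpha' (inverse_g (snd z))) (- real n) = alpha' (inverse_g (snd z))" by linarith+
          then show ?case by (simp add: En_def nlr)
        qed
      qed
    qed
    then show ?thesis by (intro exI[of _ "\<lambda>_. 0"]) simp
  next
    \<comment> \<open>This class fixes \<alpha> to 0, so the competitor is \<open>ref\<close>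
      without its anchor term.\<close>
    let ?e = "(inverse_g, \<lambda>z z'. d z z' + 0 + alpha' z')"
    assume "is_optimal (INCE_loss K ppos pneg) (estimators X {\<lambda>_. 0} d) (f, \<delta>)"
    moreover have "?e \<in> estimators X {\<lambda>_. 0} d"
      using estimators_inverse_g[of "\<lambda>_. 0" "{\<lambda>_. 0}" alpha'] by simp
    ultimately have o: "\<bar>INCE_loss K ppos pneg (f, \<delta>)\<bar> \<noteq> \<infinity>" "INCE_loss K ppos pneg (f, \<delta>) \<le> INCE_loss K ppos pneg ?e"
      by (auto simp: is_optimal_def)
    \<comment> \<open>The loss does not see a term depending on the anchor only.\<close>
    have "INCE_loss K ppos pneg ?e = INCE_loss K ppos pneg ref"
    proof -
      have "exp (- (x + 0 + b)) / (exp (- (x + 0 + b)) + (\<Sum>i=1..K. exp (- (y i + 0 + b' i)))) =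
          exp (- (x + a + b)) / (exp (- (x + a + b)) + (\<Sum>i=1..K. exp (- (y i + a + b' i))))"
        for x a b :: real and y b' :: "nat \<Rightarrow> real"
      proof -
        have e: "exp (- (u + a + v)) = exp (- a) * exp (- (u + 0 + v))" for u v :: real by (simp flip: exp_add)
        show ?thesis unfolding e[of x] e[of "y _"] sum_distrib_left[symmetric] distrib_left[symmetric] by simp
      qed
      then show ?thesis unfolding INCE_loss_def ref_def prod.case by simp
    qed
    have "\<exists>a. AE z in px \<Otimes>\<^sub>M pneg. D z = neg_log_ratio z + a (fst z)"
      by (rule INCE_minimizer[OF prob_space_px pneg(1) K ppos_eq prob_space_ppos D measurable_neg_log_ratio])
        (use o[unfolded \<open>INCE_loss K ppos pneg ?e = INCE_loss K ppos pneg ref\<close>] in \<open>simp_all add: INCE_loss_def unfold\<close>)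
    then show ?thesis .
  qed
  then obtain a where "AE z in px \<Otimes>\<^sub>M pneg. D z = neg_log_ratio z + a (fst z)" by blast
  then show "\<exists>a b. AE s in ps. AE t in L. d (f (g s)) (f (g t)) = d s t + a s + b t"
    unfolding D_def by (rule AE_pos_imp_AE_latent)
qed

end

text \<open>\<open>d\<close> is translation invariant and \<open>f\<close> enters the losses only
  through \<delta>, so an offset \<open>b\<close> cannot be excluded. Changes of \<open>f\<close> on
  null sets are invisible to the losses as well; hence the form is claimed on all of
  \<open>S\<close> for continuous \<open>f\<close>, and \<open>ps\<close>-almost everywhere if
  \<open>ps\<close>-null sets are Lebesgue null.\<close>

theorem theorem2:
  fixes S :: "(real^'n::finite) set" and X :: "(real^'m::finite) set"
    and g :: "real^'n \<Rightarrow> real^'m"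
    and ps :: "(real^'n) measure" and pneg :: "(real^'m) measure"
    and Q :: "real^'n \<Rightarrow> real" and \<sigma> :: "'n \<Rightarrow> real" and \<beta> :: real and K :: nat
    and f :: "real^'m \<Rightarrow> real^'n" and \<delta> :: "real^'n \<Rightarrow> real^'n \<Rightarrow> real"
  defines "d \<equiv> scaled_dist \<sigma> \<beta>"
    and "px \<equiv> obs_marginal X g ps"
    and "ppos \<equiv> obs_pos X g (latent_pos S ps Q (scaled_dist \<sigma> \<beta>))"
  assumes dims: "CARD('n) \<le> CARD('m)"
    and S: "open S" "connected S"
    and g: "bij_betw g S X" "g differentiable_on S"
    and \<beta>: "\<beta> \<in> {0<..<2} \<union> {2<..}"
    and \<sigma>: "\<And>i. \<sigma> i > 0"
    and ps: "prob_space ps" "sets ps = sets (restrict_space borel S)"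
    and ps_support: "\<And>U. open U \<Longrightarrow> U \<subseteq> S \<Longrightarrow> U \<noteq> {} \<Longrightarrow> emeasure ps U > 0"
    and Q: "Q \<in> borel_measurable (restrict_space borel S)" "\<And>t. t \<in> S \<Longrightarrow> Q t > 0"
    and Z: "\<And>s. s \<in> S \<Longrightarrow> partition_fn S Q d s > 0"
    and pneg: "prob_space pneg"
      "has_nonzero_density (obs_marginal X g (restrict_space lborel S)) pneg"
    and K: "K \<ge> 1"
    and optimal:
      "is_optimal (NCE_loss ppos px pneg) (estimators X (borel_measurable borel) d) (f, \<delta>)
       \<or> is_optimal (INCE_loss K ppos pneg) (estimators X {\<lambda>_. 0} d) (f, \<delta>)
       \<or> is_optimal (SCL_loss ppos px pneg) (estimators X (borel_measurable borel) d) (f, \<delta>)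
       \<or> is_optimal (NWJ_loss ppos px pneg) (estimators X (borel_measurable borel) d) (f, \<delta>)"
  shows "\<exists>A b. generalized_permutation A \<and>
           (continuous_on X f \<longrightarrow> (\<forall>s\<in>S. (f \<circ> g) s = A *v s + b)) \<and>
           (absolutely_continuous ps (restrict_space lborel S) \<longrightarrow>
              (AE s in ps. (f \<circ> g) s = A *v s + b))"
proof -
  have cg: "continuous_on S g" using g(2) by (rule differentiable_imp_continuous_on)
  have gS: "g ` S = X" using g(1) by (simp add: bij_betw_def)
  obtain w where w: "w \<in> borel_measurable (obs_marginal X g (restrict_space lborel S))"
    "\<And>x. x \<in> space (obs_marginal X g (restrict_space lborel S)) \<Longrightarrow> 0 < w x"
    "pneg = density (obs_marginal X g (restrict_space lborel S)) (\<lambda>x. ennreal (w x))"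
    using pneg(2) unfolding has_nonzero_density_def by auto
  have "0 < \<beta>" using \<beta> by auto
  moreover have "w \<in> borel_measurable (restrict_space borel X)" using w(1) by (simp add: obs_marginal_def)
  moreover have "0 < w x" if "x \<in> X" for x
    using that w(2)[of x] by (simp add: obs_marginal_def space_restrict_space)
  ultimately interpret M: latent_model S X g ps pneg Q \<sigma> \<beta> w
    using S(1) g(1) cg \<sigma> ps Q Z[unfolded d_def] pneg(1) w(3) by (intro latent_model.intro)
  note opt = M.optimal_imp_AE_latent[OF K optimal[unfolded d_def px_def ppos_def]]
  obtain a b where ae: "AE s in ps. AE t in restrict_space lborel S.
      scaled_dist \<sigma> \<beta> ((f \<circ> g) s) ((f \<circ> g) t) = scaled_dist \<sigma> \<beta> s t + a s + b t"
    using opt(2) by auto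
  have "f \<circ> g \<in> borel_measurable (restrict_space borel S)"
    by (rule measurable_comp[OF M.measurable_g opt(1)])
  from identifiability[where \<sigma> = \<sigma>, OF \<beta> \<sigma> S ps(2) ps_support this ae]
  obtain A c where A: "generalized_permutation A" "continuous_on S (f \<circ> g) \<longrightarrow> (\<forall>s\<in>S. (f \<circ> g) s = A *v s + c)"
    "absolutely_continuous ps (restrict_space lborel S) \<longrightarrow> (AE s in ps. (f \<circ> g) s = A *v s + c)"
    by blast
  have "continuous_on S (f \<circ> g)" if "continuous_on X f"
    using cg that unfolding gS[symmetric] by (rule continuous_on_compose)
  with A show ?thesis by blast
qed

end
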